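(* Let $X=MD(G,S_0,S_1,T_0,T_1)$ be a strongly connected mixed Cayley digraph. Then $\lambda(X)<\delta(X)$ (i.e. $X$ is not max-$\lambda$) if and only if $X$ satisfies one of the following conditions. Condition 1: (1.1) there exist a non-empty proper subgroup $H$ of $G$ and an element $s_0\in S_0$ such that $\langle S_0\cup\{1_G\}\setminus\{s_0\}\rangle\leq H$ and $|H|<\delta(X)$; and (1.2) there is $t_0\in T_0$ such that $G_1=\langle S_1\rangle\leq t_0Ht_0^{-1}$, $T_1^{-1}t_0\subseteq H$ and $t_0^{-1}T_0\subseteq H$. Condition 2: (2.1) there exists a non-empty proper subgroup $H$ of $G$ such that $G_0=\langle S_0\rangle\leq H$ and $|H|<\delta(X)$; and (2.2) there are two distinct elements $t_0,t_0'\in T_0$ such that $G_1=\langle S_1\rangle\leq t_0Ht_0^{-1}$, $T_1^{-1}t_0\subseteq H$, $t_0'H\cap t_0H=\varnothing$ and $t_0^{-1}(T_0\setminus\{t_0'\})\subseteq H$. Condition 3: (3.1) there exist a non-empty proper subgroup $H$ of $G$ and an element $s_1\in S_1$ such that $\langle S_1\cup\{1_G\}\setminus\{s_1\}\rangle\leq H$ and $|H|<\delta(X)$; and (3.2) there is $t_1\in T_1$ such that $G_0=\langle S_0\rangle\leq t_1^{-1}Ht_1$, $T_0t_1^{-1}\subseteq H$ and $t_1T_1^{-1}\subseteq H$. Condition 4: (4.1) there exists a non-empty proper subgroup $H$ of $G$ such that $G_1=\langle S_1\rangle\leq H$ and $|H|<\delta(X)$; and (4.2) there are two distinct elements $t_1,t_1'\in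 T_1$ such that $G_0=\langle S_0\rangle\leq t_1^{-1}Ht_1$, $T_0t_1^{-1}\subseteq H$, $t_1'^{-1}H\cap t_1^{-1}H=\varnothing$ and $t_1(T_1^{-1}\setminus\{t_1'^{-1}\})\subseteq H$.
   Context: $G$ is a finite group with identity $1_G$, $S_0,S_1\subseteq G\setminus\{1_G\}$, $T_0,T_1\subseteq G$. The mixed Cayley digraph $X=MD(G,S_0,S_1,T_0,T_1)$ has vertex set $G\times\{0,1\}$ and arcs $((g,i),(sg,i))$ for $g\in G$, $s\in S_i$, $i=0,1$; $((g,0),(tg,1))$ for $g\in G$, $t\in T_0$; and $((tg,1),(g,0))$ for $g\in G$, $t\in T_1$. $\delta(X)$ is the minimum over all vertices of all in-degrees and out-degrees; $\lambda(X)$ is the arc-connectivity (minimum number of arcs whose removal leaves a non-strongly-connected digraph). $X$ is max-$\lambda$ if $\lambda(X)=\delta(X)$. For $U\subseteq G$, $\langle U\rangle$ is the subgroup generated by $U$, $U^{-1}=\{u^{-1}:u\in U\}$, and products such as $aUb$ are elementwise. *)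

theory Defs
  imports "HOL-Algebra.Generated_Groups" "Graph_Theory.Graph_Theory"
begin

text \<open>The vertex set is \<open>G \<times> {0,1}\<close>; the connection sets act by left multiplication.
  Arcs are pairs of vertices, so the digraph has no parallel arcs.\<close>

definition mixed_cayley_digraph ::
  "('a, 'b) monoid_scheme \<Rightarrow> 'a set \<Rightarrow> 'a set \<Rightarrow> 'a set \<Rightarrow> 'a set \<Rightarrow> ('a \<times> nat) pair_pre_digraph"
  where "mixed_cayley_digraph G S0 S1 T0 T1 =
    \<lparr> pverts = carrier G \<times> {0, 1},
      parcs =
        {((g, 0), (s \<otimes>\<^bsub>G\<^esub> g, 0)) |g s. g \<in> carrier G \<and> s \<in> S0} \<union>
        {((g, 1), (s \<otimes>\<^bsub>G\<^esub> g, 1)) |g s. g \<in> carrier G \<and> s \<in> S1} \<union>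
        {((g, 0), (t \<otimes>\<^bsub>G\<^esub> g, 1)) |g t. g \<in> carrier G \<and> t \<in> T0} \<union>
        {((t \<otimes>\<^bsub>G\<^esub> g, 1), (g, 0)) |g t. g \<in> carrier G \<and> t \<in> T1} \<rparr>"

definition min_degree :: "('v, 'e) pre_digraph \<Rightarrow> nat"
  where "min_degree D = Min (in_degree D ` verts D \<union> out_degree D ` verts D)"

text \<open>Meaningful for digraphs with at least two vertices: a digraph with a single vertex stays
  strongly connected whatever arcs are removed, and the \<open>LEAST\<close> is then unspecified.\<close>

definition arc_connectivity :: "('v, 'e) pre_digraph \<Rightarrow> nat"
  where "arc_connectivity D =
    (LEAST k. \<exists>F. F \<subseteq> arcs D \<and> finite F \<and> card F = k \<and>
       \<not> strongly_connected (D\<lparr>arcs := arcs D - F\<rparr>))"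

end

(*
  The number of arcs leaving a vertex set is submodular. Among the vertex sets attaining the minimum
  of this number, for the digraph or its reversal, one of least size (an atom) is therefore a block
  for right translation, and so consists of at most one left coset of a subgroup H on each of the two
  levels. If the minimum is smaller than the minimum degree d, then a degree count shows that the atom
  has more than d vertices. The number of arcs leaving it is a multiple of |H|, positive and less
  than d, so the atom has a coset on both levels and exactly |H| arcs leave it: precisely one
  connection element maps one of the two cosets outside the atom. The four conditions describe which
  of the four connection sets contains this element. Conversely such a pair of cosets is left by at
  most |H| < d arcs.
*)

theory Submission
  imports Defs
begin

section \<open>Arc cuts of relations\<close>

text \<open>Uncrossing two minimum cuts A and B that meet gives information only if A \<union> B is
  still a proper vertex set. Atoms must therefore have at most half of the vertices. A smallest
  minimum cut of the digraph alone can violate this; its complement is then the small set, but as a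
  cut of the reversed digraph. This is why the reversal enters. A pair of cosets of H is left by
  equally many connection elements in both directions, so a pair found for the reversal serves the
  digraph itself.

  The passage to the four conditions meets another obstacle: they put a subgroup itself on one level
  and need an element t leading from it into the coset on the other level. Strong connectivity
  supplies connection elements between the levels. If the only one were the element that leaves the
  pair, the minimum degree would be at most |H|, contrary to |H| < \<delta>.\<close>

definition arc_cut :: "'v rel \<Rightarrow> 'v set \<Rightarrow> 'v rel"
  where "arc_cut R A = {(x, y) \<in> R. x \<in> A \<and> y \<notin> A}"

lemma finite_arc_cut: "finite R \<Longrightarrow> finite (arc_cut R A)"
  by (rule finite_subset[of _ R]) (auto simp: arc_cut_def)

text \<open>An arc leaving A \<inter> B or A \<union> B leaves A or B, and an arc leaving both of
  the former leaves both of the latter. The inequality follows from |X \<union> Y| + |X \<inter> Y|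
  = |X| + |Y|, used on both sides.\<close>

lemma card_arc_cut_submodular:
  assumes "finite R"
  shows "card (arc_cut R (A \<inter> B)) + card (arc_cut R (A \<union> B)) \<le> card (arc_cut R A) + card (arc_cut R B)"
proof -
  have fin: "finite (arc_cut R X)" for X
    using assms by (rule finite_arc_cut)
  have "card (arc_cut R (A \<inter> B)) + card (arc_cut R (A \<union> B))
      = card (arc_cut R (A \<inter> B) \<union> arc_cut R (A \<union> B)) + card (arc_cut R (A \<inter> B) \<inter> arc_cut R (A \<union> B))"
    using fin by (intro card_Un_Int)
  also have "\<dots> \<le> card (arc_cut R A \<union> arc_cut R B) + card (arc_cut R A \<inter> arc_cut R B)"
    using fin by (intro add_mono card_mono finite_UnI finite_Int) (auto simp: arc_cut_def)
  also have "\<dots> = card (arc_cut R A) + card (arc_cut R B)"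
    using fin by (intro card_Un_Int[symmetric])
  finally show ?thesis .
qed

lemma card_arc_cut_converse:
  assumes "R \<subseteq> V \<times> V"
  shows "card (arc_cut (R\<inverse>) B) = card (arc_cut R (V - B))"
proof -
  have "arc_cut (R\<inverse>) B = (arc_cut R (V - B))\<inverse>"
    using assms by (auto simp: arc_cut_def)
  then show ?thesis by (simp add: card_inverse)
qed

lemma card_arc_cut_image:
  assumes "R \<subseteq> V \<times> V" and "bij_betw f V V" and "A \<subseteq> V"
    and "\<And>x y. x \<in> V \<Longrightarrow> y \<in> V \<Longrightarrow> (f x, f y) \<in> R \<longleftrightarrow> (x, y) \<in> R"
  shows "card (arc_cut R (f ` A)) = card (arc_cut R A)"
proof -
  have inj: "inj_on f V" and im: "f ` V = V"
    using assms(2) by (auto simp: bij_betw_def)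
  have "arc_cut R (f ` A) = map_prod f f ` arc_cut R A"
  proof (intro equalityI subsetI)
    fix p assume "p \<in> arc_cut R (f ` A)"
    then obtain x y where p: "p = (f x, y)" "(f x, y) \<in> R" "x \<in> A" "y \<notin> f ` A"
      by (auto simp: arc_cut_def)
    moreover obtain z where "z \<in> V" "y = f z"
      using p(2) assms(1) im by blast
    ultimately have "(x, z) \<in> arc_cut R A" "p = map_prod f f (x, z)"
      using assms(3,4) by (auto simp: arc_cut_def)
    then show "p \<in> map_prod f f ` arc_cut R A" by blast
  next
    fix p assume "p \<in> map_prod f f ` arc_cut R A"
    then obtain x y where p: "p = (f x, f y)" "(x, y) \<in> R" "x \<in> A" "y \<notin> A"
      by (auto simp: arc_cut_def)
    then have "x \<in> V" "y \<in> V" using assms(1) by auto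
    moreover from this p(4) have "f y \<notin> f ` A"
      using inj assms(3) by (auto dest: inj_onD)
    ultimately show "p \<in> arc_cut R (f ` A)"
      using p assms(4) by (auto simp: arc_cut_def)
  qed
  moreover have "inj_on (map_prod f f) (arc_cut R A)"
  proof (rule inj_on_subset)
    show "inj_on (map_prod f f) (V \<times> V)" using inj inj by (rule map_prod_inj_on)
    show "arc_cut R A \<subseteq> V \<times> V" using assms(1) by (auto simp: arc_cut_def)
  qed
  ultimately show ?thesis by (simp add: card_image)
qed

text \<open>Without loops, a vertex of A has at most |A| - 1 out-neighbours in A, hence at least d +
  1 - |A| outside. The sum |A| (d + 1 - |A|) exceeds d by (|A| - 1)(d - |A|), which is not negative
  for 1 \<le> |A| \<le> d.\<close>

lemma card_arc_cut_ge_degree: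
  assumes "finite R" and "irrefl R" and "A \<noteq> {}" and "card A \<le> d"
    and "finite A" and deg: "\<And>x. x \<in> A \<Longrightarrow> d \<le> card (R `` {x})"
  shows "d \<le> card (arc_cut R A)"
proof -
  have fin: "finite (R `` {x})" for x using \<open>finite R\<close> by simp
  have each: "d + 1 - card A \<le> card (R `` {x} - A)" if "x \<in> A" for x
  proof -
    have "R `` {x} \<subseteq> (R `` {x} - A) \<union> (A - {x})"
      using \<open>irrefl R\<close> by (auto simp: irrefl_def)
    then have "card (R `` {x}) \<le> card (R `` {x} - A) + card (A - {x})"
      using fin \<open>finite A\<close> by (meson card_Un_le card_mono finite_Diff finite_UnI le_trans)
    moreover have "card A > 0" using that \<open>finite A\<close> by (auto simp: card_gt_0_iff)
    ultimately show ?thesis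
      using deg[OF that] that \<open>finite A\<close> by (simp add: card_Diff_singleton)
  qed
  have "arc_cut R A = (SIGMA x:A. R `` {x} - A)"
    by (auto simp: arc_cut_def)
  then have "card (arc_cut R A) = (\<Sum>x\<in>A. card (R `` {x} - A))"
    using \<open>finite A\<close> fin by (simp add: card_SigmaI)
  also have "\<dots> \<ge> (\<Sum>x\<in>A. d + 1 - card A)"
    using each by (intro sum_mono)
  finally have "card A * (d + 1 - card A) \<le> card (arc_cut R A)" by simp
  moreover have "d \<le> card A * (d + 1 - card A)"
  proof -
    obtain m where m: "card A = Suc m"
      using \<open>A \<noteq> {}\<close> \<open>finite A\<close> by (metis card_eq_0_iff not0_implies_Suc)
    then obtain n where "d = Suc m + n" using \<open>card A \<le> d\<close> le_Suc_ex by metis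
    with m show ?thesis by simp
  qed
  ultimately show ?thesis by linarith
qed

text \<open>The bound on the size of an atom is no loss of generality: the complement has the same cut
  value for the converse relation.\<close>

definition is_atom :: "'v set \<Rightarrow> 'v rel \<Rightarrow> 'v set \<Rightarrow> bool"
  where "is_atom V R A \<longleftrightarrow> A \<subseteq> V \<and> A \<noteq> {} \<and> 2 * card A \<le> card V \<and>
    (\<forall>B\<subseteq>V. B \<noteq> {} \<longrightarrow> B \<noteq> V \<longrightarrow> card (arc_cut R A) \<le> card (arc_cut R B) \<and>
      (card (arc_cut R B) = card (arc_cut R A) \<longrightarrow> card A \<le> card B))"

lemma is_atom_proper:
  assumes "is_atom V R A" and "finite V"
  shows "A \<noteq> V"
  using assms by (auto simp: is_atom_def)

lemma is_atom_block:
  assumes "finite V" and "R \<subseteq> V \<times> V" and A: "is_atom V R A"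
    and B: "B \<subseteq> V" "card B = card A" "card (arc_cut R B) = card (arc_cut R A)" and "A \<inter> B \<noteq> {}"
  shows "A = B"
proof -
  have finR: "finite R" using assms(1,2) finite_subset by blast
  have AV: "A \<subseteq> V" "A \<noteq> {}" and half: "2 * card A \<le> card V"
    and min: "\<And>C. C \<subseteq> V \<Longrightarrow> C \<noteq> {} \<Longrightarrow> C \<noteq> V \<Longrightarrow> card (arc_cut R A) \<le> card (arc_cut R C) \<and>
      (card (arc_cut R C) = card (arc_cut R A) \<longrightarrow> card A \<le> card C)"
    using A by (auto simp: is_atom_def)
  have fin: "finite A" "finite B" using AV B(1) \<open>finite V\<close> by (auto intro: finite_subset)
  have "card (A \<union> B) + card (A \<inter> B) = 2 * card A"
    using card_Un_Int[OF fin] B(2) by simp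
  moreover have "card (A \<inter> B) > 0"
    using \<open>A \<inter> B \<noteq> {}\<close> fin by (simp add: card_gt_0_iff)
  \<comment> \<open>The size bound of atoms is used here: |A \<union> B| = 2 |A| - |A \<inter> B| <
    |V|, so the union is an admissible competitor.\<close>
  ultimately have "A \<union> B \<noteq> V" using half by auto
  moreover have "A \<inter> B \<noteq> V" using calculation AV B(1) by blast
  ultimately have "card (arc_cut R A) \<le> card (arc_cut R (A \<inter> B))" "card (arc_cut R A) \<le> card (arc_cut R (A \<union> B))"
    using min[of "A \<inter> B"] min[of "A \<union> B"] AV B(1) \<open>A \<inter> B \<noteq> {}\<close> by blast+
  with card_arc_cut_submodular[OF finR, of A B] B(3)
  have "card (arc_cut R (A \<inter> B)) = card (arc_cut R A)" by linarith
  then have "card A \<le> card (A \<inter> B)"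
    using min[of "A \<inter> B"] \<open>A \<inter> B \<noteq> V\<close> AV \<open>A \<inter> B \<noteq> {}\<close> by auto
  then have "A \<inter> B = A" "A \<inter> B = B"
    using fin B(2) card_seteq[of A "A \<inter> B"] card_seteq[of B "A \<inter> B"] by auto
  then show ?thesis by blast
qed

text \<open>The least size is taken over the minimum cuts of R and of its converse together. This
  family is closed under complement, so its smallest member has at most half of the
  vertices.\<close>

lemma atom_exists:
  assumes "finite V" and R: "R \<subseteq> V \<times> V" and A0: "A0 \<subseteq> V" "A0 \<noteq> {}" "A0 \<noteq> V"
    and min: "\<And>B. B \<subseteq> V \<Longrightarrow> B \<noteq> {} \<Longrightarrow> B \<noteq> V \<Longrightarrow> card (arc_cut R A0) \<le> card (arc_cut R B)"
  obtains A where "is_atom V R A \<and> card (arc_cut R A) = card (arc_cut R A0) \<or>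
    is_atom V (R\<inverse>) A \<and> card (arc_cut (R\<inverse>) A) = card (arc_cut R A0)"
proof -
  define P where "P A \<longleftrightarrow> A \<subseteq> V \<and> A \<noteq> {} \<and> A \<noteq> V \<and>
    (card (arc_cut R A) = card (arc_cut R A0) \<or> card (arc_cut (R\<inverse>) A) = card (arc_cut R A0))" for A
  have conv: "card (arc_cut (R\<inverse>) B) = card (arc_cut R (V - B))" for B
    using R by (rule card_arc_cut_converse)
  have min': "card (arc_cut R A0) \<le> card (arc_cut (R\<inverse>) B)" if "B \<subseteq> V" "B \<noteq> {}" "B \<noteq> V" for B
    unfolding conv using that by (intro min) auto
  have "P A0" using A0 by (simp add: P_def)
  then obtain A where A: "P A" and least: "\<And>B. P B \<Longrightarrow> card A \<le> card B"
    using ex_has_least_nat[of P A0 card] by blast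
  have "P (V - A)"
  proof -
    have "V - (V - A) = A" using A by (auto simp: P_def)
    then show ?thesis using A conv[of A] conv[of "V - A"] by (auto simp: P_def)
  qed
  then have "card A \<le> card (V - A)" by (rule least)
  moreover have "card (V - A) = card V - card A" "card A \<le> card V"
    using A \<open>finite V\<close> by (auto simp: P_def card_Diff_subset finite_subset card_mono)
  ultimately have half: "2 * card A \<le> card V" by linarith
  have l: "card A \<le> card B" if "B \<subseteq> V" "B \<noteq> {}" "B \<noteq> V"
    "card (arc_cut R B) = card (arc_cut R A0) \<or> card (arc_cut (R\<inverse>) B) = card (arc_cut R A0)" for B
    using that least by (auto simp: P_def)
  have AV: "A \<subseteq> V" "A \<noteq> {}" using A by (auto simp: P_def)
  consider "card (arc_cut R A) = card (arc_cut R A0)" | "card (arc_cut (R\<inverse>) A) = card (arc_cut R A0)"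
    using A by (auto simp: P_def)
  then show ?thesis
  proof cases
    case 1
    have "is_atom V R A"
      unfolding is_atom_def 1 using AV half min l by blast
    with 1 that show ?thesis by blast
  next
    case 2
    have "is_atom V (R\<inverse>) A"
      unfolding is_atom_def 2 using AV half min' l by blast
    with 2 that show ?thesis by blast
  qed
qed

section \<open>Strong connectivity and arc cuts\<close>

lemma not_strongly_connected_iff_cut:
  fixes D :: "('v, 'v \<times> 'v) pre_digraph"
  assumes "tail D = fst" and "head D = snd" and "verts D \<noteq> {}"
  shows "\<not> strongly_connected D \<longleftrightarrow>
    (\<exists>A\<subseteq>verts D. A \<noteq> {} \<and> A \<noteq> verts D \<and> arc_cut (arcs D) A \<inter> verts D \<times> verts D = {})"
proof -
  have ends: "arcs_ends D = arcs D"
    using assms(1,2) by (auto simp: arcs_ends_def arc_to_ends_def)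
  show ?thesis
  proof
    assume "\<not> strongly_connected D"
    then obtain u v where uv: "u \<in> verts D" "v \<in> verts D" "\<not> u \<rightarrow>\<^sup>*\<^bsub>D\<^esub> v"
      using assms(3) by (auto simp: strongly_connected_def)
    \<comment> \<open>The vertices reachable from \<open>u\<close> can be left only by arcs ending
      outside \<open>verts D\<close>, since reachability is confined to \<open>verts D\<close>.
      Hence the intersection with \<open>verts D \<times> verts D\<close>.\<close>
    define A where "A = {x. (u, x) \<in> rtrancl_on (verts D) (arcs D)}"
    have "A \<subseteq> verts D" by (auto simp: A_def dest: in_rtrancl_on_in_F)
    moreover have "u \<in> A" "v \<notin> A" using uv by (auto simp: A_def reachable_def ends)
    moreover have "arc_cut (arcs D) A \<inter> verts D \<times> verts D = {}"
      by (auto simp: arc_cut_def A_def intro: rtrancl_on_into_rtrancl_on)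
    ultimately show "\<exists>A\<subseteq>verts D. A \<noteq> {} \<and> A \<noteq> verts D \<and> arc_cut (arcs D) A \<inter> verts D \<times> verts D = {}"
      using uv by blast
  next
    assume "\<exists>A\<subseteq>verts D. A \<noteq> {} \<and> A \<noteq> verts D \<and> arc_cut (arcs D) A \<inter> verts D \<times> verts D = {}"
    then obtain A u v where A: "A \<subseteq> verts D" "arc_cut (arcs D) A \<inter> verts D \<times> verts D = {}"
      and uv: "u \<in> A" "v \<in> verts D" "v \<notin> A" by blast
    have "y \<in> A" if "(u, y) \<in> rtrancl_on (verts D) (arcs D)" for y
      using that by (rule rtrancl_on_induct[where P = "\<lambda>y. y \<in> A"]) (use A uv in \<open>auto simp: arc_cut_def\<close>)
    then have "\<not> u \<rightarrow>\<^sup>*\<^bsub>D\<^esub> v" using uv by (auto simp: reachable_def ends)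
    then show "\<not> strongly_connected D" using uv A by (auto simp: strongly_connected_def)
  qed
qed

text \<open>Removing F destroys strong connectivity exactly when F contains the whole cut of some
  proper non-empty vertex set. The set B guarantees that such an F exists, so that the
  \<open>LEAST\<close> in \<open>arc_connectivity\<close> is attained.\<close>

lemma arc_connectivity_min_cut:
  fixes P :: "'v pair_pre_digraph"
  assumes "finite (pverts P)" and arcs: "parcs P \<subseteq> pverts P \<times> pverts P"
    and B: "B \<subseteq> pverts P" "B \<noteq> {}" "B \<noteq> pverts P"
  shows "\<exists>A\<subseteq>pverts P. A \<noteq> {} \<and> A \<noteq> pverts P \<and> card (arc_cut (parcs P) A) = arc_connectivity (with_proj P)"
    and "arc_connectivity (with_proj P) \<le> card (arc_cut (parcs P) B)"
proof -
  let ?D = "with_proj P"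
  let ?Q = "\<lambda>k. \<exists>F. F \<subseteq> arcs ?D \<and> finite F \<and> card F = k \<and>
       \<not> strongly_connected (?D\<lparr>arcs := arcs ?D - F\<rparr>)"
  have fin: "finite (parcs P)" using assms(1) arcs finite_subset by blast
  have disc: "\<not> strongly_connected (?D\<lparr>arcs := arcs ?D - F\<rparr>) \<longleftrightarrow>
    (\<exists>A\<subseteq>pverts P. A \<noteq> {} \<and> A \<noteq> pverts P \<and> arc_cut (parcs P) A \<subseteq> F)" for F
  proof -
    have "arc_cut (parcs P - F) A \<inter> pverts P \<times> pverts P = {} \<longleftrightarrow> arc_cut (parcs P) A \<subseteq> F" for A
      using arcs by (auto simp: arc_cut_def)
    moreover have "pverts P \<noteq> {}" using B by auto
    ultimately show ?thesis
      by (subst not_strongly_connected_iff_cut) simp_all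
  qed
  have Q: "?Q (card (arc_cut (parcs P) A))" if "A \<subseteq> pverts P" "A \<noteq> {}" "A \<noteq> pverts P" for A
    unfolding disc
  proof (intro exI conjI)
    show "arc_cut (parcs P) A \<subseteq> arcs ?D" by (auto simp: arc_cut_def)
    show "finite (arc_cut (parcs P) A)" by (rule finite_arc_cut[OF fin])
  qed (use that in auto)
  have le: "arc_connectivity ?D \<le> card (arc_cut (parcs P) A)"
    if "A \<subseteq> pverts P" "A \<noteq> {}" "A \<noteq> pverts P" for A
    unfolding arc_connectivity_def by (rule Least_le) (rule Q[OF that])
  show "arc_connectivity ?D \<le> card (arc_cut (parcs P) B)"
    by (rule le[OF B])
  have "?Q (arc_connectivity ?D)"
    unfolding arc_connectivity_def by (rule LeastI) (rule Q[OF B])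
  then obtain F A where "finite F" "card F = arc_connectivity ?D"
    and A: "A \<subseteq> pverts P" "A \<noteq> {}" "A \<noteq> pverts P" "arc_cut (parcs P) A \<subseteq> F"
    unfolding disc by blast
  then have "card (arc_cut (parcs P) A) = arc_connectivity ?D"
    using card_mono[of F "arc_cut (parcs P) A"] le[OF A(1-3)] by simp
  then show "\<exists>A\<subseteq>pverts P. A \<noteq> {} \<and> A \<noteq> pverts P \<and> card (arc_cut (parcs P) A) = arc_connectivity ?D"
    using A by blast
qed

section \<open>Digraphs on two copies of a group\<close>

text \<open>Treating the four connection sets as a family \<open>C i j\<close>, with \<open>C 1 0\<close> equal to the inverse
  of \<open>T1\<close>, makes arc reversal the passage from \<open>C i j\<close> to the inverse of \<open>C j i\<close>.\<close>

locale two_level_cayley = group G for G (structure) +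
  fixes C :: "nat \<Rightarrow> nat \<Rightarrow> 'a set"
  assumes finite_carrier: "finite (carrier G)"
    and conn_carrier: "\<lbrakk>i \<in> {0, 1}; j \<in> {0, 1}\<rbrakk> \<Longrightarrow> C i j \<subseteq> carrier G"
    and conn_one: "i \<in> {0, 1} \<Longrightarrow> \<one> \<notin> C i i"
begin

definition V :: "('a \<times> nat) set"
  where "V = carrier G \<times> {0, 1}"

definition E :: "('a \<times> nat) rel"
  where "E = {((x, i), (y, j)) |x i y j. x \<in> carrier G \<and> y \<in> carrier G \<and>
    i \<in> {0, 1} \<and> j \<in> {0, 1} \<and> y \<otimes> inv x \<in> C i j}"

definition levels :: "(nat \<Rightarrow> 'a set) \<Rightarrow> ('a \<times> nat) set"
  where "levels P = {(x, i). i \<in> {0, 1} \<and> x \<in> P i}"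

text \<open>Right multiplication commutes with the left action of the connection sets and so yields
  automorphisms. Its orbits under a subgroup are left cosets, which is why these occur
  throughout.\<close>

definition shift :: "'a \<Rightarrow> 'a \<times> nat \<Rightarrow> 'a \<times> nat"
  where "shift h v = (fst v \<otimes> h, snd v)"

text \<open>An element c of \<open>C i j\<close> maps the coset x i H into x j H precisely when
  \<open>inv (x j) \<otimes> c \<otimes> x i\<close> lies in H. So this counts, for each pair of
  levels, the connection elements that lead out of the union of x 0 H on level 0 and x 1 H on level
  1.\<close>

definition dev :: "(nat \<Rightarrow> 'a) \<Rightarrow> 'a set \<Rightarrow> nat"
  where "dev x H = (\<Sum>i\<in>{0, 1}. \<Sum>j\<in>{0, 1}. card {c \<in> C i j. inv (x j) \<otimes> c \<otimes> x i \<notin> H})"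

lemma E_iff: "((x, i), (y, j)) \<in> E \<longleftrightarrow> x \<in> carrier G \<and> y \<in> carrier G \<and>
    i \<in> {0, 1} \<and> j \<in> {0, 1} \<and> y \<otimes> inv x \<in> C i j"
  by (auto simp: E_def)

lemma finite_V: "finite V"
  using finite_carrier by (simp add: V_def)

lemma E_subset: "E \<subseteq> V \<times> V"
  by (auto simp: E_def V_def)

lemma finite_E: "finite E"
  using E_subset finite_V finite_subset by blast

lemma irrefl_E: "irrefl E"
proof -
  have "((x, i), (x, i)) \<notin> E" for x i
    using conn_one[of i] by (cases "i \<in> {0, 1}") (simp_all add: E_iff)
  then show ?thesis by (auto simp: irrefl_def)
qed

lemma mult_inv_cancel:
  assumes "x \<in> carrier G" "y \<in> carrier G" "h \<in> carrier G"
  shows "(y \<otimes> h) \<otimes> inv (x \<otimes> h) = y \<otimes> inv x"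
proof -
  have "(y \<otimes> h) \<otimes> inv (x \<otimes> h) = y \<otimes> (h \<otimes> (inv h \<otimes> inv x))"
    using assms by (simp add: inv_mult_group m_assoc)
  also have "h \<otimes> (inv h \<otimes> inv x) = inv x"
    using assms by (simp add: m_assoc[symmetric])
  finally show ?thesis .
qed

lemma shift_inverse:
  assumes "h \<in> carrier G" "v \<in> V"
  shows "shift (inv h) (shift h v) = v" "shift h (shift (inv h) v) = v"
  using assms by (auto simp: shift_def V_def m_assoc)

lemma shift_in_V: "\<lbrakk>h \<in> carrier G; v \<in> V\<rbrakk> \<Longrightarrow> shift h v \<in> V"
  by (auto simp: shift_def V_def)

lemma bij_shift:
  assumes "h \<in> carrier G"
  shows "bij_betw (shift h) V V"
  by (rule bij_betw_byWitness[where f' = "shift (inv h)"])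
    (use assms in \<open>auto simp: shift_inverse shift_in_V\<close>)

lemma shift_E:
  assumes "h \<in> carrier G" "v \<in> V" "w \<in> V"
  shows "(shift h v, shift h w) \<in> E \<longleftrightarrow> (v, w) \<in> E"
  using assms by (cases v; cases w) (simp add: shift_def V_def E_iff mult_inv_cancel)

lemma card_cut_shift:
  assumes "h \<in> carrier G" "A \<subseteq> V"
  shows "card (arc_cut E (shift h ` A)) = card (arc_cut E A)"
  using E_subset bij_shift[OF assms(1)] assms(2) shift_E[OF assms(1)]
  by (rule card_arc_cut_image)

lemma shift_subset: "\<lbrakk>h \<in> carrier G; A \<subseteq> V\<rbrakk> \<Longrightarrow> shift h ` A \<subseteq> V"
  using shift_in_V by blast

lemma card_shift:
  assumes "h \<in> carrier G" "A \<subseteq> V"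
  shows "card (shift h ` A) = card A"
  using bij_shift[OF assms(1)] assms(2) by (meson bij_betw_def card_image inj_on_subset)

lemma is_atom_shift:
  assumes "h \<in> carrier G" "is_atom V E A"
  shows "is_atom V E (shift h ` A)"
proof -
  have "A \<subseteq> V" using assms(2) by (simp add: is_atom_def)
  then have "card (arc_cut E (shift h ` A)) = card (arc_cut E A)" "card (shift h ` A) = card A"
    "shift h ` A \<subseteq> V"
    using assms(1) by (simp_all add: card_cut_shift card_shift shift_subset)
  then show ?thesis
    using assms(2) by (simp add: is_atom_def)
qed

section \<open>Arcs leaving a union of cosets\<close>

lemma l_coset_iff:
  assumes "subgroup H G" "y \<in> carrier G" "z \<in> carrier G"
  shows "z \<in> y <# H \<longleftrightarrow> inv y \<otimes> z \<in> H"
proof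
  assume "z \<in> y <# H"
  then obtain h where "h \<in> H" "z = y \<otimes> h" by (auto simp: l_coset_def)
  then show "inv y \<otimes> z \<in> H"
    using assms subgroup.mem_carrier[OF assms(1)] by (simp add: m_assoc[symmetric])
next
  assume "inv y \<otimes> z \<in> H"
  moreover have "z = y \<otimes> (inv y \<otimes> z)" using assms by (simp add: m_assoc[symmetric])
  ultimately show "z \<in> y <# H" by (auto simp: l_coset_def)
qed

lemma l_coset_subset_carrier:
  assumes "subgroup H G" "y \<in> carrier G"
  shows "y <# H \<subseteq> carrier G"
  using assms subgroup.subset l_coset_subset_G by blast

lemma card_l_coset:
  assumes "subgroup H G" "y \<in> carrier G"
  shows "card (y <# H) = card H"
proof -
  have "y <# H = (\<lambda>h. y \<otimes> h) ` H" by (auto simp: l_coset_def)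
  moreover have "inj_on (\<lambda>h. y \<otimes> h) H"
    using assms subgroup.mem_carrier by (fastforce intro!: inj_onI)
  ultimately show ?thesis by (simp add: card_image)
qed

text \<open>Multiplication by c maps x H onto the left coset c x H, which equals y H or is disjoint
  from it. A connection element thus takes out a whole coset or nothing, which makes the cuts of
  such sets multiples of |H|.\<close>

lemma l_coset_leave:
  assumes H: "subgroup H G" and "x \<in> carrier G" "y \<in> carrier G" "c \<in> carrier G"
  shows "{z \<in> x <# H. c \<otimes> z \<notin> y <# H} = (if inv y \<otimes> c \<otimes> x \<in> H then {} else x <# H)"
proof -
  have "c \<otimes> z \<in> y <# H \<longleftrightarrow> inv y \<otimes> c \<otimes> x \<in> H" if z: "z \<in> x <# H" for z
  proof -
    obtain h where h: "h \<in> H" "z = x \<otimes> h" using z by (auto simp: l_coset_def)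
    then have "h \<in> carrier G" using H by (simp add: subgroup.mem_carrier)
    then have "c \<otimes> z \<in> y <# H \<longleftrightarrow> inv y \<otimes> c \<otimes> x \<otimes> h \<in> H"
      using assms h(2) by (simp add: l_coset_iff m_assoc)
    also have "\<dots> \<longleftrightarrow> inv y \<otimes> c \<otimes> x \<in> H"
    proof
      assume "inv y \<otimes> c \<otimes> x \<otimes> h \<in> H"
      then have "inv y \<otimes> c \<otimes> x \<otimes> h \<otimes> inv h \<in> H"
        using H h(1) by (simp add: subgroup.m_closed subgroup.m_inv_closed)
      then show "inv y \<otimes> c \<otimes> x \<in> H" using assms \<open>h \<in> carrier G\<close> by (simp add: m_assoc)
    qed (use H h(1) in \<open>simp add: subgroup.m_closed\<close>)
    finally show ?thesis .
  qed
  then show ?thesis by auto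
qed

text \<open>An arc from (x, i) to (y, j) determines its connection element c =
  \<open>y \<otimes> inv x\<close>, so the cut is in bijection with the quadruples (i, j, c, x) that
  are counted on the right.\<close>

lemma card_cut_levels:
  assumes P: "\<And>i. P i \<subseteq> carrier G"
  shows "card (arc_cut E (levels P)) =
    (\<Sum>i\<in>{0, 1}. \<Sum>j\<in>{0, 1}. \<Sum>c\<in>C i j. card {x \<in> P i. c \<otimes> x \<notin> P j})"
proof -
  let ?X = "SIGMA i:{0, 1}. SIGMA j:{0, 1}. SIGMA c:C i j. {x \<in> P i. c \<otimes> x \<notin> P j}"
  let ?f = "\<lambda>(i :: nat, j :: nat, c, x). ((x, i), (c \<otimes> x, j))"
  have C: "c \<in> carrier G" if "c \<in> C i j" "i \<in> {0, 1}" "j \<in> {0, 1}" for c i j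
    using conn_carrier that by blast
  have finC: "finite (C i j)" if "i \<in> {0, 1}" "j \<in> {0, 1}" for i j
    using conn_carrier[OF that] finite_carrier finite_subset by blast
  have finP: "finite {x \<in> P i. Q x}" for i Q
    using P[of i] finite_carrier by (auto intro: finite_subset)
  have X: "i \<in> {0, 1} \<and> j \<in> {0, 1} \<and> c \<in> C i j \<and> x \<in> P i \<and> c \<otimes> x \<notin> P j"
    "x \<in> carrier G" "c \<in> carrier G"
    if "(i, j, c, x) \<in> ?X" for i j c x
  proof -
    show *: "i \<in> {0, 1} \<and> j \<in> {0, 1} \<and> c \<in> C i j \<and> x \<in> P i \<and> c \<otimes> x \<notin> P j"
      using that by simp
    show "x \<in> carrier G" using * P by blast
    show "c \<in> carrier G" using * C by blast
  qed
  have "inj_on ?f ?X"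
  proof (rule inj_onI)
    fix u v assume uv: "u \<in> ?X" "v \<in> ?X" "?f u = ?f v"
    obtain i j c x where u: "u = (i, j, c, x)" by (rule prod_cases4)
    obtain i' j' c' x' where v: "v = (i', j', c', x')" by (rule prod_cases4)
    have *: "i = i'" "j = j'" "x = x'" "c \<otimes> x = c' \<otimes> x" using uv(3) by (auto simp: u v)
    moreover have "c = c'"
      using X(2,3)[OF uv(1)[unfolded u]] X(3)[OF uv(2)[unfolded v]] *(4) by simp
    ultimately show "u = v" by (simp add: u v)
  qed
  moreover have "arc_cut E (levels P) = ?f ` ?X"
  proof (intro equalityI subsetI)
    fix p assume p: "p \<in> arc_cut E (levels P)"
    obtain x i y j where e: "p = ((x, i), (y, j))" by (metis surj_pair)
    have E: "x \<in> carrier G" "y \<in> carrier G" "i \<in> {0, 1}" "j \<in> {0, 1}" "y \<otimes> inv x \<in> C i j"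
      and Px: "x \<in> P i"
      using p unfolding e arc_cut_def levels_def by (simp_all add: E_iff)
    have Py: "y \<notin> P j"
      using p E(4) unfolding e arc_cut_def levels_def by auto
    have y: "y \<otimes> inv x \<otimes> x = y" using E by (simp add: m_assoc)
    have "(i, j, y \<otimes> inv x, x) \<in> ?X" using E Px Py y by simp
    moreover have "p = ?f (i, j, y \<otimes> inv x, x)" using y e by simp
    ultimately show "p \<in> ?f ` ?X" by (rule rev_image_eqI)
  next
    fix p assume "p \<in> ?f ` ?X"
    then obtain u where u: "u \<in> ?X" "p = ?f u" by (rule imageE)
    obtain i j c x where e: "u = (i, j, c, x)" by (rule prod_cases4)
    note X = X[OF u(1)[unfolded e]]
    have "c \<otimes> x \<otimes> inv x = c" using X(2,3) by (simp add: m_assoc)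
    then show "p \<in> arc_cut E (levels P)"
      unfolding u(2) e arc_cut_def levels_def using X by (simp add: E_iff)
  qed
  ultimately have "card (arc_cut E (levels P)) = card ?X" by (simp add: card_image)
  also have "\<dots> = (\<Sum>i\<in>{0, 1}. \<Sum>j\<in>{0, 1}. \<Sum>c\<in>C i j. card {x \<in> P i. c \<otimes> x \<notin> P j})"
  proof -
    let ?L = "\<lambda>i j. SIGMA c:C i j. {x \<in> P i. c \<otimes> x \<notin> P j}"
    have L: "finite (?L i j)" "card (?L i j) = (\<Sum>c\<in>C i j. card {x \<in> P i. c \<otimes> x \<notin> P j})"
      if "i \<in> {0, 1}" "j \<in> {0, 1}" for i j
      using finC[OF that] finP by (auto simp: card_SigmaI intro!: finite_SigmaI)
    have M: "finite (SIGMA j:{0, 1}. ?L i j)" "card (SIGMA j:{0, 1}. ?L i j) = (\<Sum>j\<in>{0, 1}. card (?L i j))"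
      if "i \<in> {0, 1}" for i
    proof -
      have *: "\<forall>j\<in>{0, 1}. finite (?L i j)" using L(1)[OF that] by (rule ballI)
      have "finite {0, 1 :: nat}" by simp
      then show "card (SIGMA j:{0, 1}. ?L i j) = (\<Sum>j\<in>{0, 1}. card (?L i j))"
        using * by (rule card_SigmaI)
      show "finite (SIGMA j:{0, 1}. ?L i j)"
        using \<open>finite {0, 1}\<close> bspec[OF *] by (rule finite_SigmaI)
    qed
    have "\<forall>i\<in>{0, 1}. finite (SIGMA j:{0, 1}. ?L i j)"
      using M(1) by (rule ballI)
    then have "card ?X = (\<Sum>i\<in>{0, 1}. card (SIGMA j:{0, 1}. ?L i j))"
      by (intro card_SigmaI finite.intros)
    also have "\<dots> = (\<Sum>i\<in>{0, 1}. \<Sum>j\<in>{0, 1}. card (?L i j))"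
      by (rule sum.cong[OF refl], rule M(2))
    also have "\<dots> = (\<Sum>i\<in>{0, 1}. \<Sum>j\<in>{0, 1}. \<Sum>c\<in>C i j. card {x \<in> P i. c \<otimes> x \<notin> P j})"
      by (rule sum.cong[OF refl], rule sum.cong[OF refl], rule L(2))
    finally show ?thesis .
  qed
  finally show ?thesis .
qed

lemma card_cut_cosets:
  assumes H: "subgroup H G" and x: "\<And>i. x i \<in> carrier G"
  shows "card (arc_cut E (levels (\<lambda>i. x i <# H))) = card H * dev x H"
proof -
  have *: "(\<Sum>c\<in>C i j. card {z \<in> x i <# H. c \<otimes> z \<notin> x j <# H})
    = card H * card {c \<in> C i j. inv (x j) \<otimes> c \<otimes> x i \<notin> H}" if ij: "i \<in> {0, 1}" "j \<in> {0, 1}" for i j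
  proof -
    have fin: "finite (C i j)" using conn_carrier[OF ij] finite_carrier finite_subset by blast
    have "(\<Sum>c\<in>C i j. card {z \<in> x i <# H. c \<otimes> z \<notin> x j <# H})
      = (\<Sum>c\<in>C i j. if inv (x j) \<otimes> c \<otimes> x i \<notin> H then card H else 0)"
    proof (rule sum.cong[OF refl])
      fix c assume "c \<in> C i j"
      then have "c \<in> carrier G" using conn_carrier[OF ij] by blast
      then show "card {z \<in> x i <# H. c \<otimes> z \<notin> x j <# H}
        = (if inv (x j) \<otimes> c \<otimes> x i \<notin> H then card H else 0)"
        using H x by (simp add: l_coset_leave card_l_coset)
    qed
    also have "\<dots> = (\<Sum>c\<in>{c \<in> C i j. inv (x j) \<otimes> c \<otimes> x i \<notin> H}. card H)"
      using fin by (rule sum.inter_filter[symmetric])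
    finally show ?thesis by simp
  qed
  have "card (arc_cut E (levels (\<lambda>i. x i <# H)))
    = (\<Sum>i\<in>{0, 1}. \<Sum>j\<in>{0, 1}. \<Sum>c\<in>C i j. card {z \<in> x i <# H. c \<otimes> z \<notin> x j <# H})"
    by (rule card_cut_levels) (rule l_coset_subset_carrier[OF H x])
  also have "\<dots> = (\<Sum>i\<in>{0, 1}. \<Sum>j\<in>{0, 1}. card H * card {c \<in> C i j. inv (x j) \<otimes> c \<otimes> x i \<notin> H})"
    by (rule sum.cong[OF refl], rule sum.cong[OF refl], rule *)
  finally show ?thesis by (simp only: dev_def sum_distrib_left)
qed

text \<open>Here a level may be empty, unlike in \<open>card_cut_cosets\<close>; every connection
  element into an empty level takes out a full coset. This divisibility excludes atoms that lie on
  one level.\<close>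

lemma card_dvd_card_cut:
  assumes H: "subgroup H G" and P: "\<And>i. P i = {} \<or> (\<exists>b\<in>carrier G. P i = b <# H)"
  shows "card H dvd card (arc_cut E (levels P))"
proof -
  have "card H dvd card {x \<in> P i. c \<otimes> x \<notin> P j}" if c: "c \<in> carrier G" for i j c
  proof -
    consider "P i = {}" | a where "a \<in> carrier G" "P i = a <# H" "P j = {}"
      | a b where "a \<in> carrier G" "P i = a <# H" "b \<in> carrier G" "P j = b <# H"
      using P[of i] P[of j] by metis
    then show ?thesis
    proof cases
      case 3
      then show ?thesis by (simp add: l_coset_leave[OF H _ _ c] card_l_coset[OF H])
    qed (simp_all add: card_l_coset[OF H])
  qed
  then have "card H dvd (\<Sum>i\<in>{0, 1}. \<Sum>j\<in>{0, 1}. \<Sum>c\<in>C i j. card {x \<in> P i. c \<otimes> x \<notin> P j})"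
    using conn_carrier by (intro dvd_sum) (simp add: subset_iff)
  moreover have "P i \<subseteq> carrier G" for i using P[of i] l_coset_subset_carrier[OF H] by auto
  ultimately show ?thesis by (simp only: card_cut_levels)
qed

text \<open>An atom is a block for right translation, so the translations fixing it form a subgroup
  which acts transitively on each level of it.\<close>

lemma atom_levels_cosets:
  assumes A: "is_atom V E A" and one: "(\<one>, i) \<in> A"
  obtains H where "subgroup H G" "H = {x. (x, i) \<in> A}"
    and "\<And>j. {x. (x, j) \<in> A} = {} \<or> (\<exists>b\<in>carrier G. {x. (x, j) \<in> A} = b <# H)"
proof -
  have AV: "A \<subseteq> V" using A by (simp add: is_atom_def)
  then have car: "x \<in> carrier G" if "(x, j) \<in> A" for x j using that by (auto simp: V_def)
  \<comment> \<open>A translate of A has the same size and the same cut value, so once it meets A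
    the block property makes it equal to A.\<close>
  have fixed: "shift h ` A = A" if "h \<in> carrier G" "(y, j) \<in> A" "(y \<otimes> h, j) \<in> A" for h y j
  proof -
    have "(y \<otimes> h, j) \<in> shift h ` A" using that(2) by (force simp: shift_def)
    then have "A \<inter> shift h ` A \<noteq> {}" using that(3) by blast
    then show ?thesis
      using is_atom_block[OF finite_V E_subset A] shift_subset card_shift card_cut_shift AV that(1)
      by metis
  qed
  define H where "H = {x. (x, i) \<in> A}"
  have Hcar: "H \<subseteq> carrier G" using car by (auto simp: H_def)
  have Hfix: "shift h ` A = A" if "h \<in> H" for h
    using that one car by (intro fixed[of h \<one> i]) (auto simp: H_def)
  have mult: "(x \<otimes> h, j) \<in> A" if "h \<in> H" "(x, j) \<in> A" for x h j
    using Hfix[OF that(1)] imageI[OF that(2), of "shift h"] by (simp add: shift_def)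
  have "subgroup H G"
  proof (rule subgroupI)
    show "H \<noteq> {}" using one by (auto simp: H_def)
    show "a \<otimes> b \<in> H" if "a \<in> H" "b \<in> H" for a b
      using that mult by (simp add: H_def)
    show "inv a \<in> H" if "a \<in> H" for a
    proof -
      have "(\<one>, i) \<in> shift a ` A" using Hfix[OF that] one by simp
      then obtain z where z: "(z, i) \<in> A" "z \<otimes> a = \<one>" by (auto simp: shift_def)
      then have "z = inv a" using that Hcar car by (metis inv_equality subsetD)
      then show ?thesis using z by (simp add: H_def)
    qed
  qed (rule Hcar)
  moreover have "{x. (x, j) \<in> A} = {} \<or> (\<exists>b\<in>carrier G. {x. (x, j) \<in> A} = b <# H)" for j
  proof (cases "{x. (x, j) \<in> A} = {}")
    case False
    then obtain b where b: "(b, j) \<in> A" by blast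
    \<comment> \<open>The translation taking b to x on level j preserves all of A, hence also level
      i, where it moves the identity to \<open>inv b \<otimes> x\<close>. This is how one subgroup
      serves both levels.\<close>
    have "x \<in> b <# H" if "(x, j) \<in> A" for x
    proof -
      have bx: "inv b \<otimes> x \<in> carrier G" "b \<otimes> (inv b \<otimes> x) = x"
        using car b that by (auto simp: m_assoc[symmetric])
      then have "shift (inv b \<otimes> x) ` A = A" using b that by (intro fixed[of _ b j]) auto
      then have "(\<one> \<otimes> (inv b \<otimes> x), i) \<in> A"
        using imageI[OF one, of "shift (inv b \<otimes> x)"] by (simp add: shift_def)
      then have "inv b \<otimes> x \<in> H" using bx by (simp add: H_def)
      then show ?thesis using bx(2) by (force simp: l_coset_def)
    qed
    moreover have "(x, j) \<in> A" if "x \<in> b <# H" for x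
      using that mult b by (auto simp: l_coset_def)
    ultimately have "{x. (x, j) \<in> A} = b <# H" by blast
    then show ?thesis using car b by blast
  qed simp
  ultimately show ?thesis using that H_def by blast
qed

section \<open>Atoms whose cut is smaller than the minimum degree\<close>

lemma card_level_sum:
  assumes "A \<subseteq> V"
  shows "card A = card {x. (x, 0) \<in> A} + card {x. (x, 1) \<in> A}"
proof -
  have fin: "finite {x. (x, i) \<in> A}" for i
    by (rule finite_subset[OF _ finite_carrier]) (use assms in \<open>auto simp: V_def\<close>)
  have "A = (\<lambda>x. (x, 0)) ` {x. (x, 0) \<in> A} \<union> (\<lambda>x. (x, 1)) ` {x. (x, 1) \<in> A}"
    using assms by (auto simp: V_def)
  then have "card A = card ((\<lambda>x. (x, 0 :: nat)) ` {x. (x, 0) \<in> A} \<union> (\<lambda>x. (x, 1)) ` {x. (x, 1) \<in> A})"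
    by simp
  also have "\<dots> = card ((\<lambda>x. (x, 0 :: nat)) ` {x. (x, 0) \<in> A}) + card ((\<lambda>x. (x, 1 :: nat)) ` {x. (x, 1) \<in> A})"
    using fin by (intro card_Un_disjoint) auto
  also have "\<dots> = card {x. (x, 0) \<in> A} + card {x. (x, 1) \<in> A}"
    by (simp add: card_image inj_on_def)
  finally show ?thesis .
qed

lemma levels_eq:
  assumes "A \<subseteq> V"
  shows "levels (\<lambda>j. {x. (x, j) \<in> A}) = A"
  using assms by (auto simp: levels_def V_def)

lemma atom_dev_eq_1:
  assumes A: "is_atom V E A" and pos: "0 < card (arc_cut E A)" and less: "card (arc_cut E A) < d"
    and deg: "\<And>v. v \<in> V \<Longrightarrow> d \<le> card (E `` {v})"
  shows "\<exists>H x. subgroup H G \<and> H \<noteq> carrier G \<and> card H = card (arc_cut E A) \<and>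
    (\<forall>i. x i \<in> carrier G) \<and> x 0 = \<one> \<and> dev x H = 1"
proof -
  have AV: "A \<subseteq> V" "A \<noteq> {}" using A by (auto simp: is_atom_def)
  have "finite A" using AV(1) finite_V finite_subset by blast
  then have large: "d < card A"
    using card_arc_cut_ge_degree[OF finite_E irrefl_E AV(2), of d] AV deg less by fastforce
  \<comment> \<open>The subgroup can be read off a level only if that level contains the identity.
    Translating achieves this and keeps the cut value, the size and the set of levels that are
    met.\<close>
  have translate: "\<exists>B. is_atom V E B \<and> card (arc_cut E B) = card (arc_cut E A) \<and> card B = card A
      \<and> (\<one>, i) \<in> B \<and> (\<forall>j. (\<exists>x. (x, j) \<in> A) \<longleftrightarrow> (\<exists>x. (x, j) \<in> B))" if ai: "(a, i) \<in> A" for a i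
  proof (intro exI[of _ "shift (inv a) ` A"] conjI)
    have a: "a \<in> carrier G" using ai AV by (auto simp: V_def)
    show "is_atom V E (shift (inv a) ` A)" using A a by (simp add: is_atom_shift)
    show "card (arc_cut E (shift (inv a) ` A)) = card (arc_cut E A)" "card (shift (inv a) ` A) = card A"
      using a AV by (simp_all add: card_cut_shift card_shift)
    show "(\<one>, i) \<in> shift (inv a) ` A" using ai a by (force simp: shift_def)
    show "\<forall>j. (\<exists>x. (x, j) \<in> A) \<longleftrightarrow> (\<exists>x. (x, j) \<in> shift (inv a) ` A)"
      by (force simp: shift_def)
  qed
  \<comment> \<open>On a single level the translated atom would be H itself, with |H| = |A| > d,
    although |H| divides a positive number below d.\<close>
  have both: "\<exists>x. (x, i) \<in> A" if i: "i \<in> {0, 1}" for i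
  proof (rule ccontr)
    assume empty: "\<nexists>x. (x, i) \<in> A"
    obtain a j where aj: "(a, j) \<in> A" using AV(2) by auto
    then have j: "j \<in> {0, 1}" using AV(1) by (auto simp: V_def)
    obtain B where B: "is_atom V E B" "card (arc_cut E B) = card (arc_cut E A)" "card B = card A"
      "(\<one>, j) \<in> B" "\<nexists>x. (x, i) \<in> B"
      using translate[OF aj] empty by blast
    obtain H where H: "subgroup H G" "H = {x. (x, j) \<in> B}"
      and cos: "\<And>j. {x. (x, j) \<in> B} = {} \<or> (\<exists>b\<in>carrier G. {x. (x, j) \<in> B} = b <# H)"
      using atom_levels_cosets[OF B(1,4)] by metis
    have BV: "B \<subseteq> V" using B(1) by (simp add: is_atom_def)
    have "i \<noteq> j" using B(4,5) by blast
    then have "card B = card H"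
      using card_level_sum[OF BV] B(5) i j H(2) by auto
    moreover have "card H dvd card (arc_cut E B)"
      using card_dvd_card_cut[OF H(1), of "\<lambda>j. {x. (x, j) \<in> B}"] cos levels_eq[OF BV] by simp
    then have "card H \<le> card (arc_cut E B)" using pos B(2) by (simp add: dvd_imp_le)
    ultimately show False using large less B(2,3) by linarith
  qed
  obtain a where "(a, 0) \<in> A" using both[of 0] by auto
  then obtain B where B: "is_atom V E B" "card (arc_cut E B) = card (arc_cut E A)" "card B = card A"
    "(\<one>, 0) \<in> B" "\<exists>x. (x, 1) \<in> B"
    using translate[of a 0] both[of 1] by blast
  obtain H where H: "subgroup H G" "H = {x. (x, 0) \<in> B}"
    and cos: "\<And>j. {x. (x, j) \<in> B} = {} \<or> (\<exists>b\<in>carrier G. {x. (x, j) \<in> B} = b <# H)"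
    using atom_levels_cosets[OF B(1,4)] by metis
  have BV: "B \<subseteq> V" using B(1) by (simp add: is_atom_def)
  obtain b where b: "b \<in> carrier G" "{x. (x, 1) \<in> B} = b <# H" using cos[of 1] B(5) by blast
  define x where "x i = (if i = 0 then \<one> else b)" for i :: nat
  have x: "x i \<in> carrier G" for i using b by (simp add: x_def)
  have H1: "\<one> <# H = H" using H(1) by (simp add: lcos_mult_one subgroup.subset)
  have "levels (\<lambda>i. x i <# H) = levels (\<lambda>j. {x. (x, j) \<in> B})"
    using H(2) b(2) H1 by (auto simp: levels_def x_def)
  then have eqB: "levels (\<lambda>i. x i <# H) = B" using levels_eq[OF BV] by simp
  have cut: "card (arc_cut E B) = card H * dev x H"
    using card_cut_cosets[where x = x, OF H(1) x] eqB by simp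
  have "card B = 2 * card H"
    using card_level_sum[OF BV] H(2) b card_l_coset[OF H(1) b(1)] by simp
  \<comment> \<open>The factor 2 is the number of levels: the cut value is below d, and d < |A| = 2
    |H|.\<close>
  then have "card H * dev x H < card H * 2" "0 < card H * dev x H"
    using cut B(2,3) pos less large by linarith+
  then have "dev x H < 2" "0 < dev x H" by (simp_all only: mult_less_cancel1 nat_0_less_mult_iff)
  then have dev: "dev x H = 1" by simp
  have "H \<noteq> carrier G"
  proof
    assume "H = carrier G"
    then have "b <# H = carrier G"
      using b(1) l_coset_iff[OF H(1) b(1)] l_coset_subset_carrier[OF H(1) b(1)] by auto
    then have "x i <# H = carrier G" for i using H1 \<open>H = carrier G\<close> by (simp add: x_def)
    then have "levels (\<lambda>i. x i <# H) = V" by (auto simp: levels_def V_def)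
    then have "B = V" using eqB by simp
    then show False using is_atom_proper[OF B(1) finite_V] by simp
  qed
  then show ?thesis using H(1) x dev cut B(2) by (intro exI[of _ H] exI[of _ x]) (simp add: x_def)
qed

end

section \<open>Arc reversal\<close>

context two_level_cayley
begin

lemma converse_two_level_cayley: "two_level_cayley G (\<lambda>i j. m_inv G ` C j i)"
proof unfold_locales
  fix i j :: nat assume ij: "i \<in> {0, 1}" "j \<in> {0, 1}"
  show "m_inv G ` C j i \<subseteq> carrier G"
    using conn_carrier[OF ij(2,1)] by auto
  have "\<one> \<notin> m_inv G ` C i i"
  proof
    assume "\<one> \<in> m_inv G ` C i i"
    then obtain c where c: "c \<in> C i i" "\<one> = inv c" by blast
    then have "c \<in> carrier G" using conn_carrier[OF ij(1,1)] by blast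
    then have "c = \<one>" using c(2) by (metis inv_inv inv_one)
    then show False using conn_one[OF ij(1)] c(1) by simp
  qed
  then show "i \<in> {0, 1} \<Longrightarrow> \<one> \<notin> m_inv G ` C i i" .
qed (rule finite_carrier)

lemma mem_inv_image_iff:
  assumes "X \<subseteq> carrier G" "y \<in> carrier G"
  shows "y \<in> m_inv G ` X \<longleftrightarrow> inv y \<in> X"
proof
  assume "inv y \<in> X"
  then have "inv (inv y) \<in> m_inv G ` X" by (rule imageI)
  then show "y \<in> m_inv G ` X" using assms by simp
qed (use assms in auto)

lemma converse_E: "two_level_cayley.E G (\<lambda>i j. m_inv G ` C j i) = E\<inverse>"
proof -
  interpret rev: two_level_cayley G "\<lambda>i j. m_inv G ` C j i"
    by (rule converse_two_level_cayley)
  have "((x, i), (y, j)) \<in> rev.E \<longleftrightarrow> ((y, j), (x, i)) \<in> E" for x i y j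
  proof -
    have "y \<otimes> inv x \<in> m_inv G ` C j i \<longleftrightarrow> x \<otimes> inv y \<in> C j i"
      if "x \<in> carrier G" "y \<in> carrier G" "i \<in> {0, 1}" "j \<in> {0, 1}"
      using mem_inv_image_iff[OF conn_carrier[OF that(4,3)], of "y \<otimes> inv x"] that(1,2)
      by (simp add: inv_mult_group)
    then show ?thesis unfolding rev.E_iff E_iff by blast
  qed
  then show ?thesis by auto
qed

text \<open>An element c leads out of the pair of cosets exactly when its inverse does so in the
  reversed digraph, because the two group elements tested for membership in H are inverse to each
  other. A pair found for the reversal can thus be kept as it is, without passing to
  complements.\<close>

lemma converse_dev:
  assumes H: "subgroup H G" and x: "\<And>i. x i \<in> carrier G"
  shows "two_level_cayley.dev G (\<lambda>i j. m_inv G ` C j i) x H = dev x H"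
proof -
  interpret rev: two_level_cayley G "\<lambda>i j. m_inv G ` C j i"
    by (rule converse_two_level_cayley)
  have *: "card {c \<in> m_inv G ` C j i. inv (x j) \<otimes> c \<otimes> x i \<notin> H}
    = card {c \<in> C j i. inv (x i) \<otimes> c \<otimes> x j \<notin> H}" if ij: "i \<in> {0, 1}" "j \<in> {0, 1}" for i j
  proof -
    have C: "c \<in> carrier G" if "c \<in> C j i" for c using conn_carrier[OF ij(2,1)] that by blast
    have iff: "inv (x j) \<otimes> inv c \<otimes> x i \<in> H \<longleftrightarrow> inv (x i) \<otimes> c \<otimes> x j \<in> H" if "c \<in> C j i" for c
    proof -
      let ?y = "inv (x i) \<otimes> c \<otimes> x j"
      have y: "?y \<in> carrier G" "inv (x j) \<otimes> inv c \<otimes> x i = inv ?y"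
        using C[OF that] x by (simp_all add: inv_mult_group m_assoc)
      show ?thesis
        unfolding y(2) using subgroup.m_inv_closed[OF H] y(1) by (metis inv_inv)
    qed
    have "{c \<in> m_inv G ` C j i. inv (x j) \<otimes> c \<otimes> x i \<notin> H}
      = m_inv G ` {c \<in> C j i. inv (x i) \<otimes> c \<otimes> x j \<notin> H}"
      using iff by auto
    moreover have "inj_on (m_inv G) {c \<in> C j i. inv (x i) \<otimes> c \<otimes> x j \<notin> H}"
      by (rule inj_onI) (use C inv_inv in \<open>metis (no_types, lifting) mem_Collect_eq\<close>)
    ultimately show ?thesis by (simp only: card_image)
  qed
  have "rev.dev x H = (\<Sum>i\<in>{0, 1}. \<Sum>j\<in>{0, 1}. card {c \<in> C j i. inv (x i) \<otimes> c \<otimes> x j \<notin> H})"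
    unfolding rev.dev_def by (rule sum.cong[OF refl], rule sum.cong[OF refl], rule *)
  also have "\<dots> = dev x H"
    unfolding dev_def by (rule sum.swap)
  finally show ?thesis .
qed

text \<open>Both degree bounds enter because the atom obtained from the minimum cut A may belong to
  the reversal, whose out-degrees are the in-degrees here.\<close>

lemma small_min_cut_dev_eq_1:
  assumes A: "A \<subseteq> V" "A \<noteq> {}" "A \<noteq> V" and pos: "0 < card (arc_cut E A)"
    and less: "card (arc_cut E A) < d"
    and min: "\<And>B. B \<subseteq> V \<Longrightarrow> B \<noteq> {} \<Longrightarrow> B \<noteq> V \<Longrightarrow> card (arc_cut E A) \<le> card (arc_cut E B)"
    and out: "\<And>v. v \<in> V \<Longrightarrow> d \<le> card (E `` {v})"
    and inn: "\<And>v. v \<in> V \<Longrightarrow> d \<le> card (E\<inverse> `` {v})"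
  shows "\<exists>H x. subgroup H G \<and> H \<noteq> carrier G \<and> card H = card (arc_cut E A) \<and>
    (\<forall>i. x i \<in> carrier G) \<and> x 0 = \<one> \<and> dev x H = 1"
proof -
  interpret rev: two_level_cayley G "\<lambda>i j. m_inv G ` C j i"
    by (rule converse_two_level_cayley)
  have "\<exists>B. is_atom V E B \<and> card (arc_cut E B) = card (arc_cut E A) \<or>
    is_atom V (E\<inverse>) B \<and> card (arc_cut (E\<inverse>) B) = card (arc_cut E A)"
    by (rule atom_exists[OF finite_V E_subset A], erule (2) min, blast)
  then obtain B where "is_atom V E B \<and> card (arc_cut E B) = card (arc_cut E A) \<or>
    is_atom V (E\<inverse>) B \<and> card (arc_cut (E\<inverse>) B) = card (arc_cut E A)" ..
  then show ?thesis
  proof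
    assume B: "is_atom V E B \<and> card (arc_cut E B) = card (arc_cut E A)"
    have "\<exists>H x. subgroup H G \<and> H \<noteq> carrier G \<and> card H = card (arc_cut E B) \<and>
      (\<forall>i. x i \<in> carrier G) \<and> x 0 = \<one> \<and> dev x H = 1"
      by (rule atom_dev_eq_1[of B d]) (use B pos less out in simp_all)
    then show ?thesis using B by simp
  next
    assume B: "is_atom V (E\<inverse>) B \<and> card (arc_cut (E\<inverse>) B) = card (arc_cut E A)"
    have "\<exists>H x. subgroup H G \<and> H \<noteq> carrier G \<and> card H = card (arc_cut (E\<inverse>) B) \<and>
      (\<forall>i. x i \<in> carrier G) \<and> x 0 = \<one> \<and> rev.dev x H = 1"
      by (rule rev.atom_dev_eq_1[of B d, unfolded converse_E]) (use B pos less inn in simp_all)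
    then obtain H x where Hx: "subgroup H G" "H \<noteq> carrier G" "card H = card (arc_cut E A)"
      "\<forall>i. x i \<in> carrier G" "x 0 = \<one>" "rev.dev x H = 1"
      using B by auto
    moreover have "dev x H = 1" using converse_dev[OF Hx(1), of x] Hx(4,6) by simp
    ultimately show ?thesis by (intro exI[of _ H] exI[of _ x]) simp
  qed
qed

text \<open>Properness of H keeps the pair of cosets from being all of V: an h outside H gives the
  vertex (x 0 h, 0) outside the pair.\<close>

lemma coset_union_cut:
  assumes H: "subgroup H G" "H \<noteq> carrier G" and x: "\<And>i. x i \<in> carrier G"
  shows "\<exists>A\<subseteq>V. A \<noteq> {} \<and> A \<noteq> V \<and> card (arc_cut E A) = card H * dev x H"
proof (intro exI[of _ "levels (\<lambda>i. x i <# H)"] conjI)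
  have mem: "(y, i) \<in> levels (\<lambda>i. x i <# H) \<longleftrightarrow> i \<in> {0, 1} \<and> y \<in> x i <# H" for y i
    by (simp add: levels_def)
  show "levels (\<lambda>i. x i <# H) \<subseteq> V"
    using l_coset_subset_carrier[OF H(1) x] by (auto simp: levels_def V_def)
  have "x 0 \<in> x 0 <# H" using H(1) x by (simp add: l_coset_iff subgroup.one_closed)
  then have "(x 0, 0) \<in> levels (\<lambda>i. x i <# H)" by (simp add: mem)
  then show "levels (\<lambda>i. x i <# H) \<noteq> {}" by blast
  obtain h where h: "h \<in> carrier G" "h \<notin> H" using H(2) subgroup.subset[OF H(1)] by blast
  then have "x 0 \<otimes> h \<notin> x 0 <# H"
    using H(1) x by (simp add: l_coset_iff m_assoc[symmetric])
  then have "(x 0 \<otimes> h, 0) \<in> V - levels (\<lambda>i. x i <# H)"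
    using h x by (simp add: mem V_def)
  then show "levels (\<lambda>i. x i <# H) \<noteq> V" by blast
  show "card (arc_cut E (levels (\<lambda>i. x i <# H))) = card H * dev x H"
    using H(1) x by (rule card_cut_cosets)
qed

end

section \<open>Generated subgroups, conjugates and disjoint cosets\<close>

context group
begin

lemma generate_subset_iff:
  assumes "subgroup H G"
  shows "generate G U \<subseteq> H \<longleftrightarrow> U \<subseteq> H"
proof
  assume "generate G U \<subseteq> H"
  then show "U \<subseteq> H" by (auto intro: generate.incl)
qed (rule generate_subgroup_incl[OF _ assms])

lemma mem_conjugate_iff:
  assumes "H \<subseteq> carrier G" "t \<in> carrier G" "x \<in> carrier G"
  shows "x \<in> t <# H #> inv t \<longleftrightarrow> inv t \<otimes> x \<otimes> t \<in> H"
proof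
  assume "x \<in> t <# H #> inv t"
  then obtain h where "h \<in> H" "x = t \<otimes> h \<otimes> inv t" by (auto simp: l_coset_def r_coset_def)
  moreover from this have "h \<in> carrier G" using assms(1) by blast
  then have "inv t \<otimes> (t \<otimes> h \<otimes> inv t) \<otimes> t = inv t \<otimes> t \<otimes> h \<otimes> (inv t \<otimes> t)"
    using assms(2) by (simp only: m_assoc m_closed inv_closed)
  then have "inv t \<otimes> (t \<otimes> h \<otimes> inv t) \<otimes> t = h"
    using assms(2) \<open>h \<in> carrier G\<close> by simp
  ultimately show "inv t \<otimes> x \<otimes> t \<in> H" by simp
next
  assume "inv t \<otimes> x \<otimes> t \<in> H"
  moreover have "t \<otimes> (inv t \<otimes> x \<otimes> t) \<otimes> inv t = t \<otimes> inv t \<otimes> x \<otimes> (t \<otimes> inv t)"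
    using assms by (simp only: m_assoc m_closed inv_closed)
  then have "x = t \<otimes> (inv t \<otimes> x \<otimes> t) \<otimes> inv t"
    using assms by simp
  ultimately show "x \<in> t <# H #> inv t" by (auto simp only: l_coset_def r_coset_def)
qed

lemma conjugate_subgroup:
  assumes H: "subgroup H G" and t: "t \<in> carrier G"
  shows "subgroup (t <# H #> inv t) G" and "card (t <# H #> inv t) = card H"
proof -
  have Hc: "H \<subseteq> carrier G" using H by (rule subgroup.subset)
  have sub: "t <# H #> inv t \<subseteq> carrier G" using Hc t by (simp add: l_coset_subset_G r_coset_subset_G)
  note mem = mem_conjugate_iff[OF Hc t]
  show "subgroup (t <# H #> inv t) G"
  proof (rule subgroupI)
    show "t <# H #> inv t \<subseteq> carrier G" by (rule sub)
    have "\<one> \<in> t <# H #> inv t" using H t by (simp add: mem subgroup.one_closed)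
    then show "t <# H #> inv t \<noteq> {}" by blast
    fix a assume a: "a \<in> t <# H #> inv t"
    then have ac: "a \<in> carrier G" using sub by blast
    have "inv (inv t \<otimes> a \<otimes> t) \<in> H" using a ac H by (simp add: mem subgroup.m_inv_closed)
    moreover have "inv (inv t \<otimes> a \<otimes> t) = inv t \<otimes> inv a \<otimes> t"
      using ac t by (simp add: inv_mult_group m_assoc)
    ultimately show "inv a \<in> t <# H #> inv t" using ac by (simp add: mem)
    fix b assume b: "b \<in> t <# H #> inv t"
    then have bc: "b \<in> carrier G" using sub by blast
    have "(inv t \<otimes> a \<otimes> t) \<otimes> (inv t \<otimes> b \<otimes> t) \<in> H"
      using a b ac bc H by (simp add: mem subgroup.m_closed)
    moreover have "(inv t \<otimes> a \<otimes> t) \<otimes> (inv t \<otimes> b \<otimes> t) = inv t \<otimes> a \<otimes> (t \<otimes> inv t) \<otimes> b \<otimes> t"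
      using ac bc t by (simp only: m_assoc m_closed inv_closed)
    ultimately show "a \<otimes> b \<in> t <# H #> inv t" using ac bc t by (simp add: mem m_assoc)
  qed
  have "t <# H #> inv t = (\<lambda>h. t \<otimes> h \<otimes> inv t) ` H" by (auto simp: l_coset_def r_coset_def)
  moreover have "inj_on (\<lambda>h. t \<otimes> h \<otimes> inv t) H"
    by (rule inj_onI) (use Hc t in \<open>simp add: subset_iff\<close>)
  ultimately show "card (t <# H #> inv t) = card H" by (simp add: card_image)
qed

text \<open>This turns the disjointness in the conditions into the test that occurs in
  \<open>dev\<close>: for the pair H and t H it says that t' leads out.\<close>

lemma disjoint_l_cosets_iff:
  assumes H: "subgroup H G" and "t \<in> carrier G" "t' \<in> carrier G"
  shows "(t' <# H) \<inter> (t <# H) = {} \<longleftrightarrow> inv t \<otimes> t' \<notin> H"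
proof -
  have Hc: "h \<in> carrier G" if "h \<in> H" for h using H that by (simp add: subgroup.mem_carrier)
  have "inv t \<otimes> t' \<in> H" if "h \<in> H" "k \<in> H" "t' \<otimes> h = t \<otimes> k" for h k
  proof -
    have "inv t \<otimes> t' = inv t \<otimes> t' \<otimes> (h \<otimes> inv h)"
      using that Hc assms by simp
    also have "\<dots> = inv t \<otimes> (t' \<otimes> h) \<otimes> inv h"
      using that(1,2) Hc assms by (simp only: m_assoc m_closed inv_closed)
    also have "\<dots> = inv t \<otimes> t \<otimes> k \<otimes> inv h"
      using that Hc assms by (simp only: that(3) m_assoc m_closed inv_closed)
    finally have "inv t \<otimes> t' = k \<otimes> inv h"
      using that Hc assms by simp
    then show ?thesis using that H by (simp add: subgroup.m_closed subgroup.m_inv_closed)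
  qed
  moreover have "t' \<in> (t' <# H) \<inter> (t <# H)" if "inv t \<otimes> t' \<in> H"
  proof -
    have "t' = t' \<otimes> \<one>" "t' = t \<otimes> (inv t \<otimes> t')" using assms by (simp_all add: m_assoc[symmetric])
    then show ?thesis using that subgroup.one_closed[OF H] by (auto simp: l_coset_def)
  qed
  moreover have "\<exists>h\<in>H. \<exists>k\<in>H. t' \<otimes> h = t \<otimes> k" if "(t' <# H) \<inter> (t <# H) \<noteq> {}"
    using that unfolding l_coset_def by blast
  ultimately show ?thesis by blast
qed

end

section \<open>The conditions in terms of leaving connection elements\<close>

context two_level_cayley
begin

text \<open>With \<open>(i, j) = (0, 1)\<close> these are Conditions 1 and 2, and with \<open>(i, j) = (1, 0)\<close> Conditions
  3 and 4.\<close>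

definition loop_condition :: "nat \<Rightarrow> nat \<Rightarrow> nat \<Rightarrow> bool"
  where "loop_condition i j d \<longleftrightarrow>
    (\<exists>H. subgroup H G \<and> H \<noteq> {} \<and> H \<noteq> carrier G \<and> card H < d \<and>
      (\<exists>s\<in>C i i. generate G (C i i \<union> {\<one>} - {s}) \<subseteq> H) \<and>
      (\<exists>t\<in>C i j. generate G (C j j) \<subseteq> t <# H #> inv t \<and>
        C j i #> t \<subseteq> H \<and> inv t <# C i j \<subseteq> H))"

definition cross_condition :: "nat \<Rightarrow> nat \<Rightarrow> nat \<Rightarrow> bool"
  where "cross_condition i j d \<longleftrightarrow>
    (\<exists>H. subgroup H G \<and> H \<noteq> {} \<and> H \<noteq> carrier G \<and> card H < d \<and>
      generate G (C i i) \<subseteq> H \<and>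
      (\<exists>t\<in>C i j. \<exists>t'\<in>C i j. t \<noteq> t' \<and> generate G (C j j) \<subseteq> t <# H #> inv t \<and>
        C j i #> t \<subseteq> H \<and> (t' <# H) \<inter> (t <# H) = {} \<and> inv t <# (C i j - {t'}) \<subseteq> H))"

lemma conn_mem_carrier: "\<lbrakk>c \<in> C i j; i \<in> {0, 1}; j \<in> {0, 1}\<rbrakk> \<Longrightarrow> c \<in> carrier G"
  using conn_carrier by blast

lemma finite_conn: "\<lbrakk>i \<in> {0, 1}; j \<in> {0, 1}\<rbrakk> \<Longrightarrow> finite (C i j)"
  using conn_carrier finite_carrier by (rule finite_subset)

definition leaving :: "(nat \<Rightarrow> 'a) \<Rightarrow> 'a set \<Rightarrow> nat \<Rightarrow> nat \<Rightarrow> 'a set"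
  where "leaving x H i j = {c \<in> C i j. inv (x j) \<otimes> c \<otimes> x i \<notin> H}"

lemma finite_leaving: "\<lbrakk>i \<in> {0, 1}; j \<in> {0, 1}\<rbrakk> \<Longrightarrow> finite (leaving x H i j)"
  by (rule finite_subset[of _ "C i j"]) (auto simp: leaving_def finite_conn)

lemma dev_leaving:
  assumes "(i, j) \<in> {(0, 1), (1, 0)}"
  shows "dev x H = card (leaving x H i i) + card (leaving x H i j)
    + card (leaving x H j i) + card (leaving x H j j)"
  using assms by (elim insertE) (simp_all add: dev_def leaving_def)

lemma conjugate_generate_iff:
  assumes H: "subgroup H G" and t: "t \<in> carrier G" and U: "U \<subseteq> carrier G"
  shows "generate G U \<subseteq> t <# H #> inv t \<longleftrightarrow> (\<forall>s\<in>U. inv t \<otimes> s \<otimes> t \<in> H)"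
proof -
  have "generate G U \<subseteq> t <# H #> inv t \<longleftrightarrow> U \<subseteq> t <# H #> inv t"
    by (rule generate_subset_iff[OF conjugate_subgroup(1)[OF H t]])
  also have "\<dots> \<longleftrightarrow> (\<forall>s\<in>U. s \<in> t <# H #> inv t)" by (rule subset_iff[unfolded Ball_def[symmetric]])
  also have "\<dots> \<longleftrightarrow> (\<forall>s\<in>U. inv t \<otimes> s \<otimes> t \<in> H)"
    by (rule ball_cong[OF refl], rule mem_conjugate_iff[OF subgroup.subset[OF H] t subsetD[OF U]])
  finally show ?thesis .
qed

text \<open>The pair is H on level i and t H on level j. The condition alone gives only
  \<open>dev x H \<le> 1\<close>, since the exceptional s of \<open>loop_condition\<close> may lie
  in H. This is enough: the cut then has at most |H| < d arcs.\<close>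

lemma dev_le_1_if_condition:
  assumes ij: "(i, j) \<in> {(0, 1), (1, 0)}" and cond: "loop_condition i j d \<or> cross_condition i j d"
  shows "\<exists>H x. subgroup H G \<and> H \<noteq> carrier G \<and> card H < d \<and> (\<forall>i. x i \<in> carrier G) \<and> dev x H \<le> 1"
proof -
  have i: "i \<in> {0, 1}" and j: "j \<in> {0, 1}" and ne: "i \<noteq> j" using ij by auto
  note car = conn_mem_carrier[OF _ i i] conn_mem_carrier[OF _ i j] conn_mem_carrier[OF _ j i]
    conn_mem_carrier[OF _ j j]
  have main: "(\<forall>k. x k \<in> carrier G) \<and> dev x H \<le> 1"
    if H: "subgroup H G" and t: "t \<in> C i j" and jj: "generate G (C j j) \<subseteq> t <# H #> inv t"
      and ji: "C j i #> t \<subseteq> H" and one: "card {c \<in> C i i. c \<notin> H} + card {c \<in> C i j. inv t \<otimes> c \<notin> H} \<le> 1"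
      and x: "x = (\<lambda>k. if k = j then t else \<one>)" for H t x
  proof
    have tc: "t \<in> carrier G" using t by (rule car(2))
    show "\<forall>k. x k \<in> carrier G" using tc by (simp add: x)
    have "leaving x H i i = {c \<in> C i i. c \<notin> H}" "leaving x H i j = {c \<in> C i j. inv t \<otimes> c \<notin> H}"
      unfolding leaving_def x using ne car(1,2) tc by auto
    moreover have "leaving x H j j = {}"
      unfolding leaving_def x using jj conjugate_generate_iff[OF H tc conn_carrier[OF j j]] by auto
    moreover have "c \<otimes> t \<in> H" if "c \<in> C j i" for c
      using ji that by (auto simp: r_coset_def)
    then have "leaving x H j i = {}"
      unfolding leaving_def x using ne car(3) tc by auto
    ultimately show "dev x H \<le> 1" using one by (simp add: dev_leaving[OF ij])
  qed
  from cond show ?thesis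
  proof
    assume "loop_condition i j d"
    then obtain H s t where H: "subgroup H G" "H \<noteq> carrier G" "card H < d"
      and s: "generate G (C i i \<union> {\<one>} - {s}) \<subseteq> H"
      and t: "t \<in> C i j" "generate G (C j j) \<subseteq> t <# H #> inv t" "C j i #> t \<subseteq> H"
        "inv t <# C i j \<subseteq> H"
      unfolding loop_condition_def by auto
    have "C i i \<union> {\<one>} - {s} \<subseteq> H" using s by (simp only: generate_subset_iff[OF H(1)])
    then have "card {c \<in> C i i. c \<notin> H} \<le> card {s}" by (intro card_mono) auto
    moreover have none: "{c \<in> C i j. inv t \<otimes> c \<notin> H} = {}" using t(4) by (auto simp: l_coset_def)
    ultimately have "card {c \<in> C i i. c \<notin> H} + card {c \<in> C i j. inv t \<otimes> c \<notin> H} \<le> 1"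
      unfolding none by simp
    note main = main[OF H(1) t(1-3) this refl]
    show ?thesis by (rule exI, rule exI, rule conjI[OF H(1) conjI[OF H(2) conjI[OF H(3) main]]])
  next
    assume "cross_condition i j d"
    then obtain H t t' where H: "subgroup H G" "H \<noteq> carrier G" "card H < d"
      and s: "generate G (C i i) \<subseteq> H"
      and t: "t \<in> C i j" "generate G (C j j) \<subseteq> t <# H #> inv t" "C j i #> t \<subseteq> H"
        "inv t <# (C i j - {t'}) \<subseteq> H"
      unfolding cross_condition_def by auto
    have none: "{c \<in> C i i. c \<notin> H} = {}" using s by (auto simp: generate_subset_iff[OF H(1)])
    have "inv t \<otimes> c \<in> H" if "c \<in> C i j - {t'}" for c
      using t(4) that unfolding l_coset_def by blast
    then have "card {c \<in> C i j. inv t \<otimes> c \<notin> H} \<le> card {t'}" by (intro card_mono) auto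
    then have "card {c \<in> C i i. c \<notin> H} + card {c \<in> C i j. inv t \<otimes> c \<notin> H} \<le> 1"
      unfolding none by simp
    note main = main[OF H(1) t(1-3) this refl]
    show ?thesis by (rule exI, rule exI, rule conjI[OF H(1) conjI[OF H(2) conjI[OF H(3) main]]])
  qed
qed

text \<open>If \<open>t\<close> leads from the first coset into the second, the coset pair can be normalised
  to \<open>K\<close> and \<open>t K\<close>, where \<open>K\<close> is a conjugate of \<open>H\<close>.\<close>

lemma normalise_cosets:
  assumes H: "subgroup H G" and a: "a \<in> carrier G" and b: "b \<in> carrier G"
    and t: "t \<in> carrier G" "inv b \<otimes> t \<otimes> a \<in> H" and c: "c \<in> carrier G"
  defines "K \<equiv> a <# H #> inv a"
  shows "c \<in> K \<longleftrightarrow> inv a \<otimes> c \<otimes> a \<in> H"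
    and "inv t \<otimes> c \<in> K \<longleftrightarrow> inv b \<otimes> c \<otimes> a \<in> H"
    and "c \<otimes> t \<in> K \<longleftrightarrow> inv a \<otimes> c \<otimes> b \<in> H"
    and "inv t \<otimes> c \<otimes> t \<in> K \<longleftrightarrow> inv b \<otimes> c \<otimes> b \<in> H"
proof -
  \<comment> \<open>The element t a lies in b H, and h is the discrepancy: t a = b h. Tests for
    membership in K conjugate by a and so produce t a in place of b, which changes the tests for H
    only by factors h and \<open>inv h\<close> from H.\<close>
  define h where "h = inv b \<otimes> t \<otimes> a"
  have h: "h \<in> H" "h \<in> carrier G" "inv h \<in> H" "inv h \<in> carrier G"
    using t a b H by (simp_all add: h_def subgroup.m_inv_closed)
  have Hc: "H \<subseteq> carrier G" using H by (rule subgroup.subset)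
  have "b \<otimes> h = (b \<otimes> inv b) \<otimes> t \<otimes> a"
    using a b t unfolding h_def by (simp only: m_assoc m_closed inv_closed)
  then have ta: "t \<otimes> a = b \<otimes> h" using a b t by simp
  have ta': "inv a \<otimes> inv t = inv h \<otimes> inv b"
    using arg_cong[OF ta, of "m_inv G"] a b t h by (simp add: inv_mult_group)
  have right: "z \<otimes> h \<in> H \<longleftrightarrow> z \<in> H" if "z \<in> carrier G" for z
  proof
    assume "z \<otimes> h \<in> H"
    then have "z \<otimes> h \<otimes> inv h \<in> H" using h H by (simp add: subgroup.m_closed)
    then show "z \<in> H" using that h by (simp add: m_assoc)
  qed (use h H in \<open>simp add: subgroup.m_closed\<close>)
  have left: "inv h \<otimes> z \<in> H \<longleftrightarrow> z \<in> H" if "z \<in> carrier G" for z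
  proof
    assume "inv h \<otimes> z \<in> H"
    then have "h \<otimes> (inv h \<otimes> z) \<in> H" using h H by (simp add: subgroup.m_closed)
    then show "z \<in> H" using that h by (simp add: m_assoc[symmetric])
  qed (use h H in \<open>simp add: subgroup.m_closed\<close>)
  note mem = mem_conjugate_iff[OF Hc a, folded K_def]
  show "c \<in> K \<longleftrightarrow> inv a \<otimes> c \<otimes> a \<in> H" using c by (rule mem)
  have "inv t \<otimes> c \<in> K \<longleftrightarrow> inv a \<otimes> (inv t \<otimes> c) \<otimes> a \<in> H" using t c by (intro mem) simp
  also have "inv a \<otimes> (inv t \<otimes> c) \<otimes> a = (inv a \<otimes> inv t) \<otimes> c \<otimes> a"
    using a t c by (simp only: m_assoc m_closed inv_closed)
  also have "\<dots> = inv h \<otimes> (inv b \<otimes> c \<otimes> a)"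
    unfolding ta' using a b c h by (simp only: m_assoc m_closed inv_closed)
  also have "\<dots> \<in> H \<longleftrightarrow> inv b \<otimes> c \<otimes> a \<in> H" using a b c by (intro left) simp
  finally show "inv t \<otimes> c \<in> K \<longleftrightarrow> inv b \<otimes> c \<otimes> a \<in> H" .
  have "c \<otimes> t \<in> K \<longleftrightarrow> inv a \<otimes> (c \<otimes> t) \<otimes> a \<in> H" using t c by (intro mem) simp
  also have "inv a \<otimes> (c \<otimes> t) \<otimes> a = inv a \<otimes> c \<otimes> (t \<otimes> a)"
    using a t c by (simp only: m_assoc m_closed inv_closed)
  also have "\<dots> = (inv a \<otimes> c \<otimes> b) \<otimes> h"
    unfolding ta using a b c h by (simp only: m_assoc m_closed inv_closed)
  also have "\<dots> \<in> H \<longleftrightarrow> inv a \<otimes> c \<otimes> b \<in> H" using a b c by (intro right) simp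
  finally show "c \<otimes> t \<in> K \<longleftrightarrow> inv a \<otimes> c \<otimes> b \<in> H" .
  have "inv t \<otimes> c \<otimes> t \<in> K \<longleftrightarrow> inv a \<otimes> (inv t \<otimes> c \<otimes> t) \<otimes> a \<in> H" using t c by (intro mem) simp
  also have "inv a \<otimes> (inv t \<otimes> c \<otimes> t) \<otimes> a = (inv a \<otimes> inv t) \<otimes> c \<otimes> (t \<otimes> a)"
    using a t c by (simp only: m_assoc m_closed inv_closed)
  also have "\<dots> = inv h \<otimes> ((inv b \<otimes> c \<otimes> b) \<otimes> h)"
    unfolding ta ta' using a b c h by (simp only: m_assoc m_closed inv_closed)
  also have "\<dots> \<in> H \<longleftrightarrow> inv b \<otimes> c \<otimes> b \<in> H" using a b c h by (simp add: left right)
  finally show "inv t \<otimes> c \<otimes> t \<in> K \<longleftrightarrow> inv b \<otimes> c \<otimes> b \<in> H" .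
qed

lemma condition_if_leaving:
  assumes ij: "(i, j) \<in> {(0, 1), (1, 0)}" and H: "subgroup H G" "H \<noteq> carrier G" "card H < d"
    and x: "\<And>i. x i \<in> carrier G" and out: "C i j \<noteq> {}" and deg: "d \<le> card (C i i) + card (C i j)"
    and empty: "leaving x H j i = {}" "leaving x H j j = {}"
    and one: "card (leaving x H i i) + card (leaving x H i j) = 1"
  shows "loop_condition i j d \<or> cross_condition i j d"
proof -
  have i: "i \<in> {0, 1}" and j: "j \<in> {0, 1}" using ij by auto
  note car = conn_mem_carrier[OF _ i i] conn_mem_carrier[OF _ i j] conn_mem_carrier[OF _ j i]
    conn_mem_carrier[OF _ j j]
  \<comment> \<open>Right translation by \<open>inv (x i)\<close> turns the coset on level i into K.
    It turns the other coset into t K, for every t in \<open>C i j\<close> that does not leave the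
    pair; this is the form the conditions demand.\<close>
  define K where "K = x i <# H #> inv (x i)"
  have K: "subgroup K G" "card K = card H"
    using conjugate_subgroup[OF H(1) x] by (simp_all add: K_def)
  have "finite K" using subgroup.subset[OF K(1)] finite_carrier by (rule finite_subset)
  \<comment> \<open>K inherits properness from H by size.\<close>
  have "card H < card (carrier G)"
    using H subgroup.subset[OF H(1)] finite_carrier by (intro psubset_card_mono) auto
  then have K': "K \<noteq> carrier G" "K \<noteq> {}" "card K < d" using K H(3) subgroup.one_closed[OF K(1)] by auto
  have S: "c \<in> K \<longleftrightarrow> c \<notin> leaving x H i i" if "c \<in> C i i" for c
    using mem_conjugate_iff[OF subgroup.subset[OF H(1)] x car(1)[OF that]] that
    by (simp add: K_def leaving_def)
  have norm: "\<And>c. c \<in> C i j \<Longrightarrow> inv t \<otimes> c \<in> K \<longleftrightarrow> c \<notin> leaving x H i j"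
    "\<And>c. c \<in> C j i \<Longrightarrow> c \<otimes> t \<in> K" "\<And>c. c \<in> C j j \<Longrightarrow> inv t \<otimes> c \<otimes> t \<in> K"
    if t: "t \<in> C i j" "t \<notin> leaving x H i j" for t
  proof -
    have tx: "inv (x j) \<otimes> t \<otimes> x i \<in> H" using t by (simp add: leaving_def)
    note n = normalise_cosets[OF H(1) x x car(2)[OF t(1)] tx, folded K_def]
    show "inv t \<otimes> c \<in> K \<longleftrightarrow> c \<notin> leaving x H i j" if "c \<in> C i j" for c
      using n(2)[OF car(2)[OF that]] that by (simp add: leaving_def)
    show "c \<otimes> t \<in> K" if "c \<in> C j i" for c
      using n(3)[OF car(3)[OF that]] that empty(1) by (auto simp: leaving_def)
    show "inv t \<otimes> c \<otimes> t \<in> K" if "c \<in> C j j" for c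
      using n(4)[OF car(4)[OF that]] that empty(2) by (auto simp: leaving_def)
  qed
  have rest: "generate G (C j j) \<subseteq> t <# K #> inv t" "C j i #> t \<subseteq> K"
    if t: "t \<in> C i j" "t \<notin> leaving x H i j" for t
  proof -
    show "generate G (C j j) \<subseteq> t <# K #> inv t"
      using norm(3)[OF t] by (simp add: conjugate_generate_iff[OF K(1) car(2)[OF t(1)] conn_carrier[OF j j]])
    show "C j i #> t \<subseteq> K" using norm(2)[OF t] by (auto simp: r_coset_def)
  qed
  consider "card (leaving x H i i) = 1" "card (leaving x H i j) = 0"
    | "card (leaving x H i i) = 0" "card (leaving x H i j) = 1"
    using one by linarith
  then show ?thesis
  proof cases
    case 1
    obtain s where s: "leaving x H i i = {s}" using 1(1) by (rule card_1_singletonE)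
    have none: "leaving x H i j = {}" using 1(2) finite_leaving[OF i j] by simp
    \<comment> \<open>No element of \<open>C i j\<close> leaves, so any of them can play the role of
      t.\<close>
    obtain t where t: "t \<in> C i j" using out by blast
    have t': "t \<notin> leaving x H i j" by (simp add: none)
    have "s \<in> C i i" using s by (auto simp: leaving_def)
    moreover have "C i i \<union> {\<one>} - {s} \<subseteq> K"
      using S s subgroup.one_closed[OF K(1)] by auto
    then have "generate G (C i i \<union> {\<one>} - {s}) \<subseteq> K" by (simp only: generate_subset_iff[OF K(1)])
    moreover have "inv t <# C i j \<subseteq> K" using norm(1)[OF t t'] none by (auto simp: l_coset_def)
    ultimately have "loop_condition i j d"
      unfolding loop_condition_def using K(1) K' t rest[OF t t'] by blast
    then show ?thesis ..
  next
    case 2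
    have none: "leaving x H i i = {}" using 2(1) finite_leaving[OF i i] by simp
    obtain t' where t': "leaving x H i j = {t'}" using 2(2) by (rule card_1_singletonE)
    then have t'C: "t' \<in> C i j" by (auto simp: leaving_def)
    have sub: "C i i \<subseteq> K" using S none by auto
    \<comment> \<open>The condition needs a t different from t'. If there were none, then d \<le>
      |\<open>C i i\<close>| + 1; but \<open>C i i\<close> lies in K and omits the identity, so this
      is at most |K| < d.\<close>
    have "C i j \<noteq> {t'}"
    proof
      assume "C i j = {t'}"
      then have "d \<le> card (C i i) + 1" using deg by simp
      moreover have "card (C i i) \<le> card (K - {\<one>})"
        using sub conn_one[OF i] \<open>finite K\<close> by (intro card_mono) auto
      moreover have "card (K - {\<one>}) < card K"
        using \<open>finite K\<close> subgroup.one_closed[OF K(1)] by (intro card_Diff1_less)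
      ultimately show False using K'(3) by linarith
    qed
    then obtain t where t: "t \<in> C i j" "t \<noteq> t'" using t'C by blast
    then have t2: "t \<notin> leaving x H i j" by (simp add: t')
    have "(t' <# K) \<inter> (t <# K) = {}"
      using norm(1)[OF t(1) t2 t'C] t'
      by (simp add: disjoint_l_cosets_iff[OF K(1) car(2)[OF t(1)] car(2)[OF t'C]])
    moreover have "inv t <# (C i j - {t'}) \<subseteq> K"
      using norm(1)[OF t(1) t2] t' by (auto simp: l_coset_def)
    moreover have "generate G (C i i) \<subseteq> K" using sub by (simp only: generate_subset_iff[OF K(1)])
    ultimately have "cross_condition i j d"
      unfolding cross_condition_def using K(1) K' t t'C rest[OF t(1) t2] by blast
    then show ?thesis ..
  qed
qed

text \<open>The case split is on the level where the single leaving element starts. Either level can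
  occur, so \<open>out\<close> and \<open>deg\<close> are demanded for both orders of the
  levels.\<close>

lemma condition_if_dev_eq_1:
  assumes H: "subgroup H G" "H \<noteq> carrier G" "card H < d" and x: "\<And>i. x i \<in> carrier G"
    and dev: "dev x H = 1"
    and out: "\<And>i j. (i, j) \<in> {(0, 1), (1, 0)} \<Longrightarrow> C i j \<noteq> {}"
    and deg: "\<And>i j. (i, j) \<in> {(0, 1), (1, 0)} \<Longrightarrow> d \<le> card (C i i) + card (C i j)"
  shows "\<exists>(i, j)\<in>{(0, 1), (1, 0)}. loop_condition i j d \<or> cross_condition i j d"
proof -
  have sum: "card (leaving x H 0 0) + card (leaving x H 0 1)
    + card (leaving x H 1 0) + card (leaving x H 1 1) = 1"
    using dev_leaving[of 0 1 x H] dev by simp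
  have fin: "finite (leaving x H 0 0)" "finite (leaving x H 0 1)" "finite (leaving x H 1 0)"
    "finite (leaving x H 1 1)"
    by (simp_all add: finite_leaving)
  consider "card (leaving x H 0 0) + card (leaving x H 0 1) = 1" "card (leaving x H 1 0) = 0"
      "card (leaving x H 1 1) = 0"
    | "card (leaving x H 1 1) + card (leaving x H 1 0) = 1" "card (leaving x H 0 1) = 0"
      "card (leaving x H 0 0) = 0"
    using sum by linarith
  then show ?thesis
  proof cases
    case 1
    then have "leaving x H 1 0 = {}" "leaving x H 1 1 = {}" using fin by simp_all
    then have "loop_condition 0 1 d \<or> cross_condition 0 1 d"
      by (intro condition_if_leaving[where x = x, OF _ H x out deg]) (use 1 in simp_all)
    then show ?thesis by simp
  next
    case 2
    then have "leaving x H 0 1 = {}" "leaving x H 0 0 = {}" using fin by simp_all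
    then have "loop_condition 1 0 d \<or> cross_condition 1 0 d"
      by (intro condition_if_leaving[where x = x, OF _ H x out deg]) (use 2 in simp_all)
    then show ?thesis by simp
  qed
qed

end

section \<open>Mixed Cayley digraphs\<close>

text \<open>An arc from (t g, 1) to (g, 0) multiplies by the inverse of t, hence the inverse set of
  \<open>T1\<close>. Every index other than 0 is read as 1.\<close>

definition mixed_conn ::
  "('a, 'b) monoid_scheme \<Rightarrow> 'a set \<Rightarrow> 'a set \<Rightarrow> 'a set \<Rightarrow> 'a set \<Rightarrow> nat \<Rightarrow> nat \<Rightarrow> 'a set"
  where "mixed_conn G S0 S1 T0 T1 i j =
    (if i = 0 then if j = 0 then S0 else T0 else if j = 0 then set_inv\<^bsub>G\<^esub> T1 else S1)"

locale mixed_cayley = group G for G (structure) +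
  fixes S0 S1 T0 T1 :: "'a set"
  assumes fin: "finite (carrier G)"
    and S0: "S0 \<subseteq> carrier G - {\<one>}" and S1: "S1 \<subseteq> carrier G - {\<one>}"
    and T0: "T0 \<subseteq> carrier G" and T1: "T1 \<subseteq> carrier G"

sublocale mixed_cayley \<subseteq> two_level_cayley G "mixed_conn G S0 S1 T0 T1"
proof unfold_locales
  fix i j :: nat
  show "mixed_conn G S0 S1 T0 T1 i j \<subseteq> carrier G"
    using S0 S1 T0 T1 by (auto simp: mixed_conn_def SET_INV_def)
  show "i \<in> {0, 1} \<Longrightarrow> \<one> \<notin> mixed_conn G S0 S1 T0 T1 i i"
    using S0 S1 by (auto simp: mixed_conn_def)
qed (rule fin)

section \<open>Degrees and arc-connectivity of the mixed Cayley digraph\<close>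

context mixed_cayley
begin

abbreviation "MD \<equiv> mixed_cayley_digraph G S0 S1 T0 T1"

lemma pverts_digraph: "pverts MD = V"
  by (simp add: mixed_cayley_digraph_def V_def)

lemma mult_mult_inv: "\<lbrakk>x \<in> carrier G; y \<in> carrier G\<rbrakk> \<Longrightarrow> x \<otimes> y \<otimes> inv y = x"
  by (simp add: m_assoc)

lemma mult_inv_mult: "\<lbrakk>x \<in> carrier G; y \<in> carrier G\<rbrakk> \<Longrightarrow> x \<otimes> inv y \<otimes> y = x"
  by (simp add: m_assoc)

lemma parcs_digraph: "parcs MD = E"
proof (intro equalityI subsetI)
  fix p assume "p \<in> parcs MD"
  then consider g s where "p = ((g, 0), (s \<otimes> g, 0))" "g \<in> carrier G" "s \<in> S0"
    | g s where "p = ((g, 1), (s \<otimes> g, 1))" "g \<in> carrier G" "s \<in> S1"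
    | g t where "p = ((g, 0), (t \<otimes> g, 1))" "g \<in> carrier G" "t \<in> T0"
    | g t where "p = ((t \<otimes> g, 1), (g, 0))" "g \<in> carrier G" "t \<in> T1"
    unfolding mixed_cayley_digraph_def by auto
  then show "p \<in> E"
  proof cases
    case (1 g s)
    then have "s \<in> carrier G" using S0 by blast
    with 1 show ?thesis by (simp add: E_iff mixed_conn_def mult_mult_inv)
  next
    case (2 g s)
    then have "s \<in> carrier G" using S1 by blast
    with 2 show ?thesis by (simp add: E_iff mixed_conn_def mult_mult_inv)
  next
    case (3 g t)
    then have "t \<in> carrier G" using T0 by blast
    with 3 show ?thesis by (simp add: E_iff mixed_conn_def mult_mult_inv)
  next
    case (4 g t)
    then have t: "t \<in> carrier G" using T1 by blast
    have "inv t \<in> set_inv T1" using 4(3) by (auto simp: SET_INV_def)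
    moreover have "g \<otimes> inv (t \<otimes> g) = inv t"
      using 4(2) t by (simp add: inv_mult_group m_assoc[symmetric])
    ultimately show ?thesis using 4 t by (simp add: E_iff mixed_conn_def)
  qed
next
  fix p assume "p \<in> E"
  then obtain x i y j where p: "p = ((x, i), (y, j))" "x \<in> carrier G" "y \<in> carrier G"
    "i \<in> {0, 1}" "j \<in> {0, 1}" "y \<otimes> inv x \<in> mixed_conn G S0 S1 T0 T1 i j"
    unfolding E_def by blast
  let ?c = "y \<otimes> inv x"
  have y: "y = ?c \<otimes> x" using p by (simp add: mult_inv_mult)
  consider "i = 0" "j = 0" "?c \<in> S0" | "i = 1" "j = 1" "?c \<in> S1" | "i = 0" "j = 1" "?c \<in> T0"
    | t where "i = 1" "j = 0" "t \<in> T1" "?c = inv t"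
    using p(4-6) by (auto simp: mixed_conn_def SET_INV_def)
  then show "p \<in> parcs MD"
  proof cases
    case 1
    then have "p \<in> {((g, 0), (s \<otimes> g, 0)) |g s. g \<in> carrier G \<and> s \<in> S0}" using p(1,2) y by blast
    then show ?thesis by (simp add: mixed_cayley_digraph_def)
  next
    case 2
    then have "p \<in> {((g, 1), (s \<otimes> g, 1)) |g s. g \<in> carrier G \<and> s \<in> S1}" using p(1,2) y by blast
    then show ?thesis by (simp add: mixed_cayley_digraph_def)
  next
    case 3
    then have "p \<in> {((g, 0), (t \<otimes> g, 1)) |g t. g \<in> carrier G \<and> t \<in> T0}" using p(1,2) y by blast
    then show ?thesis by (simp add: mixed_cayley_digraph_def)
  next
    case (4 t)
    then have t: "t \<in> carrier G" using T1 by blast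
    have "t \<otimes> y = t \<otimes> (?c \<otimes> x)" using y by simp
    also have "\<dots> = t \<otimes> inv t \<otimes> x" unfolding 4(4) using t p(2) by (simp only: m_assoc m_closed inv_closed)
    finally have "x = t \<otimes> y" using t p(2) by simp
    then have "p \<in> {((t \<otimes> g, 1), (g, 0)) |g t. g \<in> carrier G \<and> t \<in> T1}" using p(1,3) 4 by blast
    then show ?thesis by (simp add: mixed_cayley_digraph_def)
  qed
qed

text \<open>Arcs are pairs of vertices, so degrees are numbers of neighbours in the relation
  \<open>E\<close>.\<close>

lemma min_degree_le:
  assumes "v \<in> V"
  shows "min_degree (with_proj MD) \<le> card (E `` {v})"
    and "min_degree (with_proj MD) \<le> card (E\<inverse> `` {v})"
proof -
  let ?D = "with_proj MD"
  have "out_arcs ?D v = Pair v ` (E `` {v})"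
    by (auto simp: out_arcs_def parcs_digraph)
  then have "out_degree ?D v = card (E `` {v})"
    by (simp add: out_degree_def card_image inj_on_def)
  moreover have "in_arcs ?D v = (\<lambda>u. (u, v)) ` (E\<inverse> `` {v})"
    by (auto simp: in_arcs_def parcs_digraph)
  then have "in_degree ?D v = card (E\<inverse> `` {v})"
    by (simp add: in_degree_def card_image inj_on_def)
  moreover have "min_degree ?D \<le> out_degree ?D v" "min_degree ?D \<le> in_degree ?D v"
    unfolding min_degree_def using assms finite_V by (auto simp: pverts_digraph intro!: Min_le)
  ultimately show "min_degree ?D \<le> card (E `` {v})" "min_degree ?D \<le> card (E\<inverse> `` {v})"
    by simp_all
qed

text \<open>The out-neighbours of the identity on level i are given by the two connection sets that
  start there. This bound is what later provides a second element of \<open>C i j\<close>.\<close>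

lemma min_degree_le_conn:
  assumes ij: "(i, j) \<in> {(0, 1), (1, 0)}"
  shows "min_degree (with_proj MD)
    \<le> card (mixed_conn G S0 S1 T0 T1 i i) + card (mixed_conn G S0 S1 T0 T1 i j)"
proof -
  let ?C = "mixed_conn G S0 S1 T0 T1"
  have i: "i \<in> {0, 1}" and j: "j \<in> {0, 1}" using ij by auto
  have "v \<in> (\<lambda>c. (c, i)) ` ?C i i \<union> (\<lambda>c. (c, j)) ` ?C i j" if "v \<in> E `` {(\<one>, i)}" for v
  proof -
    obtain y k where v: "v = (y, k)" by (cases v)
    then have "y \<in> carrier G" "k \<in> {0, 1}" "y \<otimes> inv \<one> \<in> ?C i k" using that by (auto simp: E_iff)
    moreover from this have "k = i \<or> k = j" using ij by auto
    ultimately show ?thesis using v by (auto simp del: One_nat_def)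
  qed
  then have "E `` {(\<one>, i)} \<subseteq> (\<lambda>c. (c, i)) ` ?C i i \<union> (\<lambda>c. (c, j)) ` ?C i j" by blast
  then have "card (E `` {(\<one>, i)}) \<le> card ((\<lambda>c. (c, i)) ` ?C i i \<union> (\<lambda>c. (c, j)) ` ?C i j)"
    using finite_conn[OF i i] finite_conn[OF i j] by (intro card_mono) simp_all
  also have "\<dots> \<le> card (?C i i) + card (?C i j)"
    using finite_conn[OF i i] finite_conn[OF i j]
    by (intro card_Un_le[THEN le_trans] add_mono card_image_le)
  finally show ?thesis using min_degree_le(1)[of "(\<one>, i)"] i by (simp add: V_def)
qed

lemma arc_connectivity_less_min_degree_iff:
  assumes sc: "strongly_connected (with_proj MD)"
  defines "d \<equiv> min_degree (with_proj MD)"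
  shows "arc_connectivity (with_proj MD) < d \<longleftrightarrow>
    (\<exists>(i, j)\<in>{(0, 1), (1, 0)}. loop_condition i j d \<or> cross_condition i j d)"
proof -
  let ?C = "mixed_conn G S0 S1 T0 T1" and ?k = "arc_connectivity (with_proj MD)"
  \<comment> \<open>A full level is a reference set for the minimum cut, and also a set that only
    arcs between the levels can leave. The other level has index 1 - i.\<close>
  have level: "carrier G \<times> {i} \<subseteq> V" "carrier G \<times> {i} \<noteq> {}" "carrier G \<times> {i} \<noteq> V"
    if "i \<in> {0, 1}" for i :: nat
  proof -
    show "carrier G \<times> {i} \<subseteq> V" using that by (auto simp: V_def)
    show "carrier G \<times> {i} \<noteq> {}" using one_closed by blast
    have "(\<one>, 1 - i) \<in> V" "(\<one>, 1 - i) \<notin> carrier G \<times> {i}" using that by (auto simp: V_def)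
    then show "carrier G \<times> {i} \<noteq> V" by blast
  qed
  have P: "finite (pverts MD)" "parcs MD \<subseteq> pverts MD \<times> pverts MD"
    unfolding pverts_digraph parcs_digraph by (rule finite_V, rule E_subset)
  note conn = arc_connectivity_min_cut[OF P, unfolded pverts_digraph parcs_digraph]
  \<comment> \<open>Strong connectivity in terms of cuts. It makes the minimum cut positive, which
    rules out the value 0 of \<open>dev\<close> for the cosets of an atom.\<close>
  have cut: "arc_cut E A \<noteq> {}" if A: "A \<subseteq> V" "A \<noteq> {}" "A \<noteq> V" for A
  proof
    assume "arc_cut E A = {}"
    then have "\<exists>A\<subseteq>V. A \<noteq> {} \<and> A \<noteq> V \<and> arc_cut E A \<inter> V \<times> V = {}"
      using A by (intro exI[of _ A]) simp
    moreover have "V \<noteq> {}" using A by blast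
    ultimately have "\<not> strongly_connected (with_proj MD)"
      by (subst not_strongly_connected_iff_cut) (simp_all only: with_proj_simps pverts_digraph parcs_digraph simp_thms)
    with sc show False by contradiction
  qed
  \<comment> \<open>Some arc leaves the full level i, and its connection element belongs to
    \<open>?C i j\<close>.\<close>
  have out: "?C i j \<noteq> {}" if ij: "(i, j) \<in> {(0, 1), (1, 0)}" for i j
  proof -
    have "i \<in> {0, 1}" using ij by auto
    note level = level[OF this]
    have "arc_cut E (carrier G \<times> {i}) \<noteq> {}" by (rule cut[OF level])
    then obtain x k y l where p: "((x, k), (y, l)) \<in> arc_cut E (carrier G \<times> {i})" by fast
    then have E: "((x, k), (y, l)) \<in> E" and k: "k = i" and l: "y \<in> carrier G \<longrightarrow> l \<noteq> i"
      by (auto simp: arc_cut_def)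
    have "y \<in> carrier G" "l \<in> {0, 1}" "y \<otimes> inv x \<in> ?C i l" using E k by (simp_all add: E_iff)
    moreover from this have "l = j" using l ij by auto
    ultimately show ?thesis by blast
  qed
  show ?thesis
  proof
    assume less: "?k < d"
    have "\<exists>A\<subseteq>V. A \<noteq> {} \<and> A \<noteq> V \<and> card (arc_cut E A) = ?k"
      by (rule conn(1)[OF level[of 0]]) simp_all
    then obtain A where A: "A \<subseteq> V" "A \<noteq> {}" "A \<noteq> V" "card (arc_cut E A) = ?k" by blast
    have pos: "0 < card (arc_cut E A)"
      using cut[OF A(1-3)] finite_arc_cut[OF finite_E] by (simp add: card_gt_0_iff)
    have "\<exists>H x. subgroup H G \<and> H \<noteq> carrier G \<and> card H = card (arc_cut E A) \<and>
      (\<forall>i. x i \<in> carrier G) \<and> x 0 = \<one> \<and> dev x H = 1"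
      using A(1-3) pos less[folded A(4)]
    proof (rule small_min_cut_dev_eq_1)
      show "card (arc_cut E A) \<le> card (arc_cut E B)" if "B \<subseteq> V" "B \<noteq> {}" "B \<noteq> V" for B
        unfolding A(4) using that by (rule conn(2))
      show "d \<le> card (E `` {v})" "d \<le> card (E\<inverse> `` {v})" if "v \<in> V" for v
        unfolding d_def using that by (rule min_degree_le)+
    qed
    then obtain H x where H: "subgroup H G" "H \<noteq> carrier G" "card H = card (arc_cut E A)"
      and x: "\<forall>i. x i \<in> carrier G" "dev x H = 1" by (elim exE conjE)
    have "card H < d" using less A(4) H(3) by simp
    then show "\<exists>(i, j)\<in>{(0, 1), (1, 0)}. loop_condition i j d \<or> cross_condition i j d"
      by (rule condition_if_dev_eq_1[OF H(1,2) _ spec[OF x(1)] x(2) out min_degree_le_conn[folded d_def]])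
  next
    assume "\<exists>(i, j)\<in>{(0, 1), (1, 0)}. loop_condition i j d \<or> cross_condition i j d"
    then obtain p where p: "p \<in> {(0, 1), (1, 0)}"
      and cond: "loop_condition (fst p) (snd p) d \<or> cross_condition (fst p) (snd p) d"
      unfolding case_prod_unfold by (rule bexE)
    have "(fst p, snd p) \<in> {(0, 1), (1, 0)}" using p by (simp only: prod.collapse)
    then have "\<exists>H x. subgroup H G \<and> H \<noteq> carrier G \<and> card H < d \<and> (\<forall>i. x i \<in> carrier G) \<and> dev x H \<le> 1"
      using cond by (rule dev_le_1_if_condition)
    then obtain H x where H: "subgroup H G" "H \<noteq> carrier G" "card H < d"
      and x: "\<forall>i. x i \<in> carrier G" and dev: "dev x H \<le> 1" by (elim exE conjE)
    obtain A where A: "A \<subseteq> V" "A \<noteq> {}" "A \<noteq> V" "card (arc_cut E A) = card H * dev x H"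
      using coset_union_cut[where x = x, OF H(1,2) spec[OF x]] by (elim exE conjE)
    have "?k \<le> card (arc_cut E A)" by (rule conn(2)[OF A(1-3)])
    moreover have "card H * dev x H \<le> card H * 1" using dev by (rule mult_le_mono2)
    ultimately show "?k < d" using H(3) A(4) by linarith
  qed
qed

text \<open>The elements leading from level 1 to level 0 are the inverses of those of
  \<open>T1\<close>, so t in the general condition becomes \<open>inv t1\<close>. Inversion is an
  injective involution on the carrier, which carries over the distinctness of two elements and the
  conjugate of H.\<close>

lemma conditions_swapped:
  shows "loop_condition 1 0 d \<longleftrightarrow>
    (\<exists>H. subgroup H G \<and> H \<noteq> {} \<and> H \<noteq> carrier G \<and> card H < d \<and>
      (\<exists>s1\<in>S1. generate G (S1 \<union> {\<one>} - {s1}) \<subseteq> H) \<and>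
      (\<exists>t1\<in>T1. generate G S0 \<subseteq> inv t1 <# H #> t1 \<and>
        T0 #> inv t1 \<subseteq> H \<and> t1 <# set_inv T1 \<subseteq> H))" (is ?loop)
    and "cross_condition 1 0 d \<longleftrightarrow>
    (\<exists>H. subgroup H G \<and> H \<noteq> {} \<and> H \<noteq> carrier G \<and> card H < d \<and>
      generate G S1 \<subseteq> H \<and>
      (\<exists>t1\<in>T1. \<exists>t1'\<in>T1. t1 \<noteq> t1' \<and> generate G S0 \<subseteq> inv t1 <# H #> t1 \<and>
        T0 #> inv t1 \<subseteq> H \<and> (inv t1' <# H) \<inter> (inv t1 <# H) = {} \<and>
        t1 <# (set_inv T1 - {inv t1'}) \<subseteq> H))" (is ?cross)
proof -
  have bex: "(\<exists>t\<in>set_inv T1. Q t) \<longleftrightarrow> (\<exists>t\<in>T1. Q (inv t))" for Q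
    by (simp add: SET_INV_def)
  have inv_inv_T1: "inv (inv t) = t" if "t \<in> T1" for t
    using T1 that by (simp add: subset_iff)
  have inj: "inv t = inv t' \<longleftrightarrow> t = t'" if "t \<in> T1" "t' \<in> T1" for t t'
    using inv_inv_T1 that by metis
  show ?loop
    unfolding loop_condition_def by (simp add: mixed_conn_def bex inv_inv_T1 cong: bex_cong)
  show ?cross
    unfolding cross_condition_def by (simp add: mixed_conn_def bex inv_inv_T1 inj cong: bex_cong)
qed

end

theorem theorem3p12:
  fixes G :: "('a, 'b) monoid_scheme" (structure)
    and S0 S1 T0 T1 :: "'a set"
    and D :: "('a \<times> nat, ('a \<times> nat) \<times> ('a \<times> nat)) pre_digraph"
  assumes "group G" and "finite (carrier G)"
    and "S0 \<subseteq> carrier G - {\<one>}" and "S1 \<subseteq> carrier G - {\<one>}"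
    and "T0 \<subseteq> carrier G" and "T1 \<subseteq> carrier G"
    and "D = with_proj (mixed_cayley_digraph G S0 S1 T0 T1)"
    and "strongly_connected D"
  shows "arc_connectivity D < min_degree D \<longleftrightarrow>
      (\<exists>H. subgroup H G \<and> H \<noteq> {} \<and> H \<noteq> carrier G \<and> card H < min_degree D \<and>
        (\<exists>s0\<in>S0. generate G (S0 \<union> {\<one>} - {s0}) \<subseteq> H) \<and>
        (\<exists>t0\<in>T0. generate G S1 \<subseteq> t0 <# H #> inv t0 \<and>
          set_inv T1 #> t0 \<subseteq> H \<and> inv t0 <# T0 \<subseteq> H))
    \<or> (\<exists>H. subgroup H G \<and> H \<noteq> {} \<and> H \<noteq> carrier G \<and> card H < min_degree D \<and>
        generate G S0 \<subseteq> H \<and>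
        (\<exists>t0\<in>T0. \<exists>t0'\<in>T0. t0 \<noteq> t0' \<and> generate G S1 \<subseteq> t0 <# H #> inv t0 \<and>
          set_inv T1 #> t0 \<subseteq> H \<and> (t0' <# H) \<inter> (t0 <# H) = {} \<and>
          inv t0 <# (T0 - {t0'}) \<subseteq> H))
    \<or> (\<exists>H. subgroup H G \<and> H \<noteq> {} \<and> H \<noteq> carrier G \<and> card H < min_degree D \<and>
        (\<exists>s1\<in>S1. generate G (S1 \<union> {\<one>} - {s1}) \<subseteq> H) \<and>
        (\<exists>t1\<in>T1. generate G S0 \<subseteq> inv t1 <# H #> t1 \<and>
          T0 #> inv t1 \<subseteq> H \<and> t1 <# set_inv T1 \<subseteq> H))
    \<or> (\<exists>H. subgroup H G \<and> H \<noteq> {} \<and> H \<noteq> carrier G \<and> card H < min_degree D \<and>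
        generate G S1 \<subseteq> H \<and>
        (\<exists>t1\<in>T1. \<exists>t1'\<in>T1. t1 \<noteq> t1' \<and> generate G S0 \<subseteq> inv t1 <# H #> t1 \<and>
          T0 #> inv t1 \<subseteq> H \<and> (inv t1' <# H) \<inter> (inv t1 <# H) = {} \<and>
          t1 <# (set_inv T1 - {inv t1'}) \<subseteq> H))"
proof -
  interpret mixed_cayley G S0 S1 T0 T1
    using assms(1-6) by (simp add: mixed_cayley_def mixed_cayley_axioms_def)
  have sc: "strongly_connected (with_proj (mixed_cayley_digraph G S0 S1 T0 T1))"
    using assms(7,8) by simp
  have split: "(\<exists>(i, j)\<in>{(0, 1), (1, 0)}. loop_condition i j d \<or> cross_condition i j d) \<longleftrightarrow>
    loop_condition 0 1 d \<or> cross_condition 0 1 d \<or> loop_condition 1 0 d \<or> cross_condition 1 0 d" for d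
    by auto
  have conn: "mixed_conn G S0 S1 T0 T1 0 0 = S0" "mixed_conn G S0 S1 T0 T1 0 1 = T0"
    "mixed_conn G S0 S1 T0 T1 1 0 = set_inv T1" "mixed_conn G S0 S1 T0 T1 1 1 = S1"
    by (simp_all add: mixed_conn_def)
  show ?thesis
    unfolding assms(7) arc_connectivity_less_min_degree_iff[OF sc] split conditions_swapped
      loop_condition_def[of 0 1] cross_condition_def[of 0 1] conn ..
qed

end
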